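(* Let $q$ be a prime power, $\ell\geq 2$, and let $\mathcal{A}$ be a central hyperplane arrangement in $\mathbb{F}_q^\ell$. If $\chi(\mathcal{A},q^{\ell-2})=0$, then $\mathcal{A}$ is free with exponents $(1,q,q^2,\dots,q^{\ell-2},\ |\mathcal{A}|-1-q-q^2-\cdots-q^{\ell-2})$.
   Context: A (central) hyperplane arrangement $\mathcal{A}$ in $V=\mathbb{K}^\ell$ is a finite set of codimension-one linear subspaces. Characteristic polynomial: $\chi(\mathcal{A},t)=\sum_{X\in L(\mathcal{A})}\mu(X)t^{\dim X}$, where $L(\mathcal{A})$ is the set of intersections of subsets of $\mathcal{A}$ (including $V$) ordered by reverse inclusion with minimum $\hat0=V$, and $\mu(\hat0)=1$, $\mu(X)=-\sum_{Y<X}\mu(Y)$ for $X>\hat0$. Let $S=\mathbb{K}[x_1,\dots,x_\ell]$, fix for each $H\in\mathcal{A}$ a nonzero linear form $\alpha_H$ with kernel $H$; $D(\mathcal{A})=\{\delta\in \mathrm{Der}_V : \delta(\alpha_H)\in\alpha_H S\ \forall H\in\mathcal{A}\}$, where $\mathrm{Der}_V=\bigoplus_i S\,\partial/\partial x_i$. $\mathcal{A}$ is free if $D(\mathcal{A})$ is a free $S$-module; the exponents are the multiset of degrees of a homogeneous basis. *)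

theory Defs
  imports "HOL-Analysis.Cartesian_Space" "HOL-Library.Poly_Mapping" "HOL-Computational_Algebra.Polynomial"
begin

definition lin_ker :: "'a::field ^ 'n \<Rightarrow> ('a ^ 'n) set" where
  "lin_ker a = {x. (\<Sum>i\<in>UNIV. a $ i * x $ i) = 0}"

definition is_hyperplane :: "('a::field ^ 'n) set \<Rightarrow> bool" where
  "is_hyperplane H \<longleftrightarrow> (\<exists>a. a \<noteq> 0 \<and> H = lin_ker a)"

definition central_arrangement :: "('a::field ^ 'n) set set \<Rightarrow> bool" where
  "central_arrangement A \<longleftrightarrow> finite A \<and> (\<forall>H\<in>A. is_hyperplane H)"

definition int_lattice :: "('a::field ^ 'n) set set \<Rightarrow> ('a ^ 'n) set set" where
  "int_lattice A = {\<Inter>B | B. B \<subseteq> A}"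

text \<open>Moebius function of L(A), ordered by reverse inclusion (X < Y iff Y is a proper subset of X):
  mu(V) = 1 and mu(X) = - sum_{Y<X} mu(Y); extended by 0 outside L(A).\<close>
definition moebius :: "('a::field ^ 'n) set set \<Rightarrow> ('a ^ 'n) set \<Rightarrow> int" where
  "moebius A = (THE f. f UNIV = 1
      \<and> (\<forall>X\<in>int_lattice A. X \<noteq> UNIV \<longrightarrow> f X = - (\<Sum>Y\<in>{Y\<in>int_lattice A. X \<subset> Y}. f Y))
      \<and> (\<forall>X. X \<notin> int_lattice A \<longrightarrow> f X = 0))"

definition char_poly :: "('a::field ^ 'n) set set \<Rightarrow> int poly" where
  "char_poly A = (\<Sum>X\<in>int_lattice A. monom (moebius A X) (vec.dim X))"

type_synonym ('a, 'n) mpoly = "('n \<Rightarrow>\<^sub>0 nat) \<Rightarrow>\<^sub>0 'a"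

text \<open>A derivation sum_i f_i d/dx_i in Der_V, represented by its coefficient vector (f_i)_i.\<close>
type_synonym ('a, 'n) deriv = "'n \<Rightarrow> ('a, 'n) mpoly"

definition mconst :: "'a::zero \<Rightarrow> ('a, 'n) mpoly" where
  "mconst c = Poly_Mapping.single 0 c"

definition mvar :: "'n \<Rightarrow> ('a::{zero,one}, 'n) mpoly" where
  "mvar i = Poly_Mapping.single (Poly_Mapping.single i 1) 1"

definition lin_poly :: "'a::field ^ 'n \<Rightarrow> ('a, 'n) mpoly" where
  "lin_poly a = (\<Sum>i\<in>UNIV. mconst (a $ i) * mvar i)"

definition apply_deriv_lin :: "('a::field, 'n::finite) deriv \<Rightarrow> 'a ^ 'n \<Rightarrow> ('a, 'n) mpoly" where
  "apply_deriv_lin \<delta> a = (\<Sum>i\<in>UNIV. mconst (a $ i) * \<delta> i)"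

definition alpha :: "('a::field ^ 'n) set \<Rightarrow> 'a ^ 'n" where
  "alpha H = (SOME a. a \<noteq> 0 \<and> H = lin_ker a)"

definition logder :: "('a::field ^ 'n::finite) set set \<Rightarrow> ('a, 'n) deriv set" where
  "logder A = {\<delta>. \<forall>H\<in>A. lin_poly (alpha H) dvd apply_deriv_lin \<delta> (alpha H)}"

definition mon_deg :: "('n \<Rightarrow>\<^sub>0 nat) \<Rightarrow> nat" where
  "mon_deg m = (\<Sum>i\<in>Poly_Mapping.keys m. Poly_Mapping.lookup m i)"

definition homogeneous_deriv :: "('a::zero, 'n) deriv \<Rightarrow> nat \<Rightarrow> bool" where
  "homogeneous_deriv \<theta> d \<longleftrightarrow> (\<exists>i. \<theta> i \<noteq> 0) \<and> (\<forall>i. \<forall>m\<in>Poly_Mapping.keys (\<theta> i). mon_deg m = d)"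

definition deriv_comb :: "('a::field, 'n) mpoly list \<Rightarrow> ('a, 'n) deriv list \<Rightarrow> ('a, 'n) deriv" where
  "deriv_comb cs ths = (\<lambda>i. (\<Sum>j<length ths. cs ! j * (ths ! j) i))"

definition is_S_basis :: "('a::field, 'n) deriv set \<Rightarrow> ('a, 'n) deriv list \<Rightarrow> bool" where
  "is_S_basis M ths \<longleftrightarrow> set ths \<subseteq> M
     \<and> (\<forall>cs. length cs = length ths \<longrightarrow> (\<forall>i. deriv_comb cs ths i = 0) \<longrightarrow> (\<forall>c\<in>set cs. c = 0))
     \<and> (\<forall>\<theta>\<in>M. \<exists>cs. length cs = length ths \<and> \<theta> = deriv_comb cs ths)"

definition free_with_exponents :: "('a::field ^ 'n::finite) set set \<Rightarrow> int multiset \<Rightarrow> bool" where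
  "free_with_exponents A E \<longleftrightarrow> (\<exists>ths ds. length ds = length ths
      \<and> (\<forall>j<length ths. homogeneous_deriv (ths ! j) (ds ! j))
      \<and> is_S_basis (logder A) ths
      \<and> mset (map int ds) = E)"

end

theory Submission
  imports Defs
begin

text \<open>
  By the theorem of Crapo and Rota, \<open>\<chi>(A, q^(\<ell>-2))\<close> counts the \<open>(\<ell>-2)\<close>-tuples of vectors contained in
  no hyperplane of \<open>A\<close>. If it vanishes, then dually the points of \<open>A\<close> meet every line of the
  projective space of linear forms. The arrangement of all hyperplanes is free with the basis
  \<open>\<theta>\<^sub>k = \<Sum>\<^sub>i x\<^sub>i^(q^k) \<partial>\<^sub>i\<close> for \<open>k < \<ell>\<close>: by induction on the dimension, a derivation which is
  logarithmic for all hyperplanes is a \<open>q\<close>-polynomial in the linear forms. From it the hyperplanes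
  outside \<open>A\<close> are deleted one at a time. If \<open>\<theta>\<^sub>0, \<dots>, \<theta>\<^bsub>\<ell>-2\<^esub>, \<theta>\<close> is a basis before the deletion of
  \<open>ker \<alpha>\<close>, then, as every line through \<open>\<alpha>\<close> still meets the arrangement, the restriction of \<open>\<theta>\<close> to
  \<open>ker \<alpha>\<close> is logarithmic for the full arrangement of \<open>ker \<alpha>\<close>. Hence
  \<open>\<theta> = \<Sum>\<^sub>k c\<^sub>k \<theta>\<^sub>k + \<alpha> \<theta>'\<close>, and replacing \<open>\<theta>\<close> by \<open>\<theta>'\<close> gives a basis after the deletion, with the
  last exponent lowered by one.
\<close>

section \<open>Subspaces\<close>

lemma (in vector_space) line_plus_subspace_unique:
  assumes "subspace W" "b \<notin> W" "v \<in> W" "w \<in> W" and same_sum: "scale c b + v = scale d b + w"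
  shows "c = d \<and> v = w"
proof -
  have "scale (c - d) b = w - v"
    using same_sum by (simp add: algebra_simps)
  then have "scale (c - d) b \<in> W"
    using assms by (simp add: subspace_diff)
  then have "scale (inverse (c - d)) (scale (c - d) b) \<in> W"
    by (rule subspace_scale[OF assms(1)])
  then have "c = d"
    using assms(2) by (cases "c = d") simp_all
  then show ?thesis
    using same_sum by simp
qed

lemma (in vector_space) bij_betw_span_insert:
  assumes "subspace W" "b \<notin> W"
  shows "bij_betw (\<lambda>(c, w). scale c b + w) (UNIV \<times> W) (span (insert b W))"
proof (rule bij_betw_imageI)
  show "inj_on (\<lambda>(c, w). scale c b + w) (UNIV \<times> W)"
    using line_plus_subspace_unique[OF assms] by (auto simp: inj_on_def)
  have "(\<exists>w\<in>W. x = scale c b + w) \<longleftrightarrow> x - scale c b \<in> W" for x c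
    by (auto intro: bexI[of _ "x - scale c b"])
  then have "x \<in> (\<lambda>(c, w). scale c b + w) ` (UNIV \<times> W) \<longleftrightarrow> (\<exists>c. x - scale c b \<in> W)" for x
    by (auto simp: image_iff)
  moreover have "span (insert b W) = {x. \<exists>c. x - scale c b \<in> W}"
    using assms(1) unfolding span_insert by (simp add: span_eq_iff[THEN iffD2])
  ultimately show "(\<lambda>(c, w). scale c b + w) ` (UNIV \<times> W) = span (insert b W)"
    by blast
qed

lemma (in finite_dimensional_vector_space) dim_span_insert:
  assumes "subspace W" "b \<notin> W"
  shows "dim (span (insert b W)) = Suc (dim W)"
  using assms by (simp add: dim_insert flip: span_eq_iff)

lemma (in finite_dimensional_vector_space) subspace_induct [consumes 1, case_names zero insert]:
  assumes "subspace W" and zero: "P {0}"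
    and insert: "\<And>b W. subspace W \<Longrightarrow> b \<notin> W \<Longrightarrow> P W \<Longrightarrow> P (span (insert b W))"
  shows "P W"
proof -
  obtain B where basis: "independent B" "span B = W"
    using basis_subspace_exists[OF assms(1)] by metis
  from finiteI_independent[OF basis(1)] basis(1) have "P (span B)"
  proof (induction B)
    case empty
    show ?case
      using zero by simp
  next
    case (insert b B)
    then have "P (span (insert b (span B)))"
      by (intro assms(3)) (auto simp: independent_insert)
    then show ?case
      by (simp add: span_insert span_span)
  qed
  then show ?thesis
    using basis(2) by simp
qed

lemma (in finite_dimensional_vector_space) card_subspace:
  assumes "subspace W"
  shows "card W = CARD('a) ^ dim W"
  using assms
proof (induction W rule: subspace_induct)
  case (insert b W)
  then show ?case
    using bij_betw_same_card[OF bij_betw_span_insert[of W b]]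
    by (simp add: card_cartesian_product dim_span_insert del: dim_span)
qed simp

section \<open>Linear forms and their kernels\<close>

lemma scalar_product_commute: "scalar_product a b = scalar_product b (a :: 'a::comm_semiring_1 ^ 'n)"
  by (simp add: scalar_product_def mult.commute)

lemma scalar_product_add_right: "scalar_product a (b + c) = scalar_product a b + scalar_product a c"
  by (simp add: scalar_product_def distrib_left sum.distrib)

lemma scalar_product_scale_right:
  "scalar_product a (k *s b) = k * scalar_product a (b :: 'a::comm_semiring_1 ^ 'n)"
  by (simp add: scalar_product_def sum_distrib_left mult.left_commute)

lemma scalar_product_diff_right:
  "scalar_product a (b - c) = scalar_product a b - scalar_product a (c :: 'a::ring_1 ^ 'n)"
  by (simp add: scalar_product_def right_diff_distrib sum_subtractf)

lemma scalar_product_scale_left: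
  "scalar_product (k *s a) b = k * scalar_product a (b :: 'a::comm_semiring_1 ^ 'n)"
  by (simp add: scalar_product_def sum_distrib_left mult.assoc)

lemma scalar_product_diff_left:
  "scalar_product (a - b) c = scalar_product a c - scalar_product b (c :: 'a::ring_1 ^ 'n)"
  by (simp add: scalar_product_def left_diff_distrib sum_subtractf)

lemma scalar_product_axis [simp]: "scalar_product a (axis i k) = a $ i * k"
  for a :: "'a::ring_1 ^ 'n::finite"
proof -
  have "scalar_product a (axis i k) = (\<Sum>j\<in>UNIV. if j = i then a $ j * k else 0)"
    unfolding scalar_product_def by (intro sum.cong) (auto simp: axis_def)
  then show ?thesis
    by simp
qed

lemma scalar_product_0_left [simp]: "scalar_product 0 b = 0"
  and scalar_product_0_right [simp]: "scalar_product b 0 = 0"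
  by (simp_all add: scalar_product_def)

lemma scalar_product_eq_1_exists:
  fixes a :: "'a::field ^ 'n::finite"
  assumes "a \<noteq> 0"
  obtains v where "scalar_product a v = 1"
proof -
  obtain i where "a $ i \<noteq> 0"
    using assms by (auto simp: vec_eq_iff)
  then show ?thesis
    using that[of "axis i (inverse (a $ i))"] by simp
qed

lemma in_lin_ker_iff: "x \<in> lin_ker a \<longleftrightarrow> scalar_product a x = 0"
  by (simp add: lin_ker_def scalar_product_def)

lemma subspace_lin_ker: "vec.subspace (lin_ker a)"
  by (rule vec.subspaceI) (simp_all add: in_lin_ker_iff scalar_product_add_right scalar_product_scale_right)

lemma lin_ker_scale: "c \<noteq> 0 \<Longrightarrow> lin_ker (c *s a) = lin_ker a"
  by (auto simp: in_lin_ker_iff scalar_product_scale_left)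

lemma lin_ker_eq_UNIV_iff [simp]: "lin_ker a = UNIV \<longleftrightarrow> a = 0"
  for a :: "'a::field ^ 'n::finite"
proof
  assume "lin_ker a = UNIV"
  then have "scalar_product a v \<noteq> 1" for v
    using in_lin_ker_iff[of v a] by simp
  then show "a = 0"
    using scalar_product_eq_1_exists by metis
qed (auto simp: in_lin_ker_iff)

lemma subspace_subset_lin_ker_diff:
  fixes a c :: "'a::field ^ 'n::finite"
  assumes subspace: "vec.subspace W" and subset: "W \<inter> lin_ker a \<subseteq> lin_ker c"
  obtains k where "W \<subseteq> lin_ker (c - k *s a)"
proof (cases "W \<subseteq> lin_ker a")
  case True
  then show ?thesis
    using subset that[of 0] by auto
next
  case False
  then obtain u where "u \<in> W" and pairing: "scalar_product a u \<noteq> 0"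
    by (meson in_lin_ker_iff subsetI)
  define k where "k = scalar_product c u / scalar_product a u"
  have "w \<in> lin_ker (c - k *s a)" if "w \<in> W" for w
  proof -
    let ?w' = "w - (scalar_product a w / scalar_product a u) *s u"
    have "?w' \<in> W"
      using subspace \<open>u \<in> W\<close> \<open>w \<in> W\<close> by (intro vec.subspace_diff vec.subspace_scale)
    moreover have "?w' \<in> lin_ker a"
      using pairing by (simp add: in_lin_ker_iff scalar_product_diff_right scalar_product_scale_right)
    ultimately have "scalar_product c ?w' = 0"
      using subset by (auto simp: in_lin_ker_iff)
    then show ?thesis
      by (simp add: in_lin_ker_iff k_def scalar_product_diff_right scalar_product_scale_right
          scalar_product_diff_left scalar_product_scale_left)
  qed
  then show ?thesis
    using that by blast
qed

lemma in_span_if_Inter_lin_ker_subset: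
  fixes B :: "('a::field ^ 'n::finite) set"
  assumes "finite B" "(\<Inter>b\<in>B. lin_ker b) \<subseteq> lin_ker c"
  shows "c \<in> vec.span B"
  using assms
proof (induction B arbitrary: c)
  case empty
  then have "c = 0"
    by (simp add: top.extremum_unique)
  then show ?case
    by simp
next
  case (insert a B)
  have "vec.subspace (\<Inter>b\<in>B. lin_ker b)"
    by (auto intro: vec.subspace_Inter subspace_lin_ker)
  moreover have "(\<Inter>b\<in>B. lin_ker b) \<inter> lin_ker a \<subseteq> lin_ker c"
    using insert.prems by auto
  ultimately obtain k where "(\<Inter>b\<in>B. lin_ker b) \<subseteq> lin_ker (c - k *s a)"
    by (rule subspace_subset_lin_ker_diff)
  then have "c - k *s a \<in> vec.span B"
    by (rule insert.IH)
  then show ?case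
    by (auto simp: vec.span_insert)
qed

lemma lin_ker_subset_iff:
  fixes a b :: "'a::field ^ 'n::finite"
  shows "lin_ker a \<subseteq> lin_ker b \<longleftrightarrow> b \<in> vec.span {a}"
proof
  assume "lin_ker a \<subseteq> lin_ker b"
  then show "b \<in> vec.span {a}"
    using in_span_if_Inter_lin_ker_subset[of "{a}" b] by simp
qed (auto simp: vec.span_singleton in_lin_ker_iff scalar_product_scale_left)

lemma dim_lin_ker:
  fixes a :: "'a::field ^ 'n::finite"
  assumes "a \<noteq> 0"
  shows "vec.dim (lin_ker a) = CARD('n) - 1"
proof -
  obtain v where pairing: "scalar_product a v = 1"
    using assms by (rule scalar_product_eq_1_exists)
  have "x - scalar_product a x *s v \<in> lin_ker a" for x
    using pairing by (simp add: in_lin_ker_iff scalar_product_diff_right scalar_product_scale_right)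
  then have "x \<in> vec.span (insert v (lin_ker a))" for x
    unfolding vec.span_insert by (auto intro: vec.span_base)
  then have "vec.span (insert v (lin_ker a)) = UNIV"
    by auto
  moreover have "v \<notin> lin_ker a"
    using pairing by (simp add: in_lin_ker_iff)
  ultimately have "CARD('n) = Suc (vec.dim (lin_ker a))"
    using vec.dim_span_insert[OF subspace_lin_ker, of v a] vec_dim_card[where 'a = 'a and 'n = 'n] by simp
  then show ?thesis
    by simp
qed

section \<open>Hyperplanes\<close>

lemma is_hyperplane_lin_ker_iff [simp]: "is_hyperplane (lin_ker a) \<longleftrightarrow> a \<noteq> 0"
  for a :: "'a::field ^ 'n::finite"
proof
  assume "is_hyperplane (lin_ker a)"
  then obtain b where "b \<noteq> 0" "lin_ker a = lin_ker b"
    by (auto simp: is_hyperplane_def)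
  then show "a \<noteq> 0"
    using lin_ker_eq_UNIV_iff by metis
qed (auto simp: is_hyperplane_def)

lemma hyperplane_neq_UNIV:
  fixes H :: "('a::field ^ 'n::finite) set"
  assumes "is_hyperplane H"
  shows "H \<noteq> UNIV"
  using assms lin_ker_eq_UNIV_iff by (metis is_hyperplane_def)

lemma alpha_hyperplane:
  assumes "is_hyperplane H"
  shows "alpha H \<noteq> 0" "lin_ker (alpha H) = H"
proof -
  have "alpha H \<noteq> 0 \<and> H = lin_ker (alpha H)"
    unfolding alpha_def using assms[unfolded is_hyperplane_def] by (rule someI_ex)
  then show "alpha H \<noteq> 0" "lin_ker (alpha H) = H"
    by metis+
qed

lemma CARD_field_gt_1: "1 < CARD('a::{field,finite})"
proof -
  have "card {0, 1 :: 'a} \<le> CARD('a)"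
    by (intro card_mono) auto
  then show ?thesis
    by simp
qed

lemma card_forms_with_kernel:
  fixes H :: "('a::{field,finite} ^ 'n::finite) set"
  assumes "is_hyperplane H"
  shows "card {a. lin_ker a = H} = CARD('a) - 1"
proof -
  obtain a where "a \<noteq> 0" and H_eq: "H = lin_ker a"
    using assms by (auto simp: is_hyperplane_def)
  have "{b. lin_ker b = H} = (\<lambda>c. c *s a) ` (UNIV - {0})"
  proof (intro equalityI subsetI)
    fix b
    assume "b \<in> {b. lin_ker b = H}"
    then have same_kernel: "lin_ker b = lin_ker a"
      using H_eq by simp
    then obtain c where "b = c *s a"
      using lin_ker_subset_iff[of a b] by (auto simp: vec.span_singleton)
    moreover have "b \<noteq> 0"
      using \<open>a \<noteq> 0\<close> same_kernel lin_ker_eq_UNIV_iff by metis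
    ultimately show "b \<in> (\<lambda>c. c *s a) ` (UNIV - {0})"
      by auto
  qed (auto simp: H_eq lin_ker_scale)
  moreover have "inj (\<lambda>c. c *s a)"
    using \<open>a \<noteq> 0\<close> by (auto intro!: injI)
  ultimately show ?thesis
    by (simp add: card_image inj_on_subset[of _ UNIV] card_Diff_singleton)
qed

lemma card_hyperplanes:
  "card {H :: ('a::{field,finite} ^ 'n::finite) set. is_hyperplane H} = (\<Sum>k<CARD('n). CARD('a) ^ k)"
proof -
  let ?q = "CARD('a)" and ?U = "{H :: ('a ^ 'n) set. is_hyperplane H}"
  have CARD_gt_1: "1 < ?q"
    by (rule CARD_field_gt_1)
  have "card (UNIV - {0 :: 'a ^ 'n}) = card (\<Union>H\<in>?U. {a. lin_ker a = H})"
    by (rule arg_cong[where f = card]) auto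
  also have "\<dots> = (\<Sum>H\<in>?U. card {a. lin_ker a = H})"
    by (rule card_UN_disjoint) auto
  also have "\<dots> = card ?U * (?q - 1)"
    by (simp add: card_forms_with_kernel)
  finally have "?q ^ CARD('n) - 1 = card ?U * (?q - 1)"
    by (simp add: card_Diff_singleton)
  then have "int (?q ^ CARD('n) - 1) = int (card ?U) * int (?q - 1)"
    by (metis of_nat_mult)
  then have "(int ?q - 1) * int (card ?U) = (int ?q - 1) * (\<Sum>k<CARD('n). int ?q ^ k)"
    using CARD_gt_1 power_diff_1_eq[of "int ?q" "CARD('n)"] by (simp add: of_nat_diff mult.commute)
  then have "int (card ?U) = int (\<Sum>k<CARD('n). ?q ^ k)"
    using CARD_gt_1 by simp
  then show ?thesis
    by (simp only: of_nat_eq_iff)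
qed

section \<open>The characteristic polynomial counts tuples\<close>

lemma UNIV_in_int_lattice [simp]: "UNIV \<in> int_lattice A"
  by (auto simp: int_lattice_def intro!: exI[of _ "{}"])

lemma central_arrangement_subspace: "central_arrangement A \<Longrightarrow> H \<in> A \<Longrightarrow> vec.subspace H"
  by (auto simp: central_arrangement_def is_hyperplane_def subspace_lin_ker)

lemma subspace_int_lattice:
  assumes "central_arrangement A" "X \<in> int_lattice A"
  shows "vec.subspace X"
proof -
  obtain B where "B \<subseteq> A" "X = \<Inter>B"
    using assms(2) by (auto simp: int_lattice_def)
  then show ?thesis
    using central_arrangement_subspace[OF assms(1)] by (auto intro: vec.subspace_Inter)
qed

function moebius_rec :: "('a::finite ^ 'n::finite) set set \<Rightarrow> ('a ^ 'n) set \<Rightarrow> int" where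
  "moebius_rec L X = (if X = UNIV then 1
     else if X \<in> L then - (\<Sum>Y\<in>{Y \<in> L. X \<subset> Y}. moebius_rec L Y) else 0)"
  by auto
termination
  by (relation "measure (\<lambda>(L, X). card (- X))") (auto intro!: psubset_card_mono)

declare moebius_rec.simps [simp del]

lemma moebius_eq_moebius_rec:
  fixes A :: "('a::{field,finite} ^ 'n::finite) set set"
  shows "moebius A = moebius_rec (int_lattice A)"
  unfolding moebius_def
proof (rule the_equality)
  let ?L = "int_lattice A"
  show "moebius_rec ?L UNIV = 1 \<and>
    (\<forall>X\<in>?L. X \<noteq> UNIV \<longrightarrow> moebius_rec ?L X = - (\<Sum>Y\<in>{Y \<in> ?L. X \<subset> Y}. moebius_rec ?L Y)) \<and>
    (\<forall>X. X \<notin> ?L \<longrightarrow> moebius_rec ?L X = 0)"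
  proof (intro conjI ballI allI impI)
    show "moebius_rec ?L X = 0" if "X \<notin> ?L" for X
      using that UNIV_in_int_lattice[of A] by (subst moebius_rec.simps) metis
  qed (subst moebius_rec.simps, simp)+
  fix f :: "('a ^ 'n) set \<Rightarrow> int"
  assume f_rec: "f UNIV = 1 \<and> (\<forall>X\<in>?L. X \<noteq> UNIV \<longrightarrow> f X = - (\<Sum>Y\<in>{Y \<in> ?L. X \<subset> Y}. f Y)) \<and>
    (\<forall>X. X \<notin> ?L \<longrightarrow> f X = 0)"
  have "f X = moebius_rec ?L X" for X
  proof (induction "card (- X)" arbitrary: X rule: less_induct)
    case less
    have "(\<Sum>Y\<in>{Y \<in> ?L. X \<subset> Y}. f Y) = (\<Sum>Y\<in>{Y \<in> ?L. X \<subset> Y}. moebius_rec ?L Y)"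
      by (rule sum.cong) (auto intro!: less psubset_card_mono)
    then show ?case
      using f_rec by (subst moebius_rec.simps) auto
  qed
  then show "f = moebius_rec ?L"
    by blast
qed

lemma sum_moebius_above:
  fixes A :: "('a::{field,finite} ^ 'n::finite) set set"
  assumes "Z \<in> int_lattice A"
  shows "(\<Sum>X\<in>{X \<in> int_lattice A. Z \<subseteq> X}. moebius A X) = (if Z = UNIV then 1 else 0)"
proof -
  let ?L = "int_lattice A"
  have "{X \<in> ?L. Z \<subseteq> X} = insert Z {X \<in> ?L. Z \<subset> X}"
    using assms by auto
  then have "(\<Sum>X\<in>{X \<in> ?L. Z \<subseteq> X}. moebius A X) = moebius A Z + (\<Sum>X\<in>{X \<in> ?L. Z \<subset> X}. moebius A X)"
    by simp
  also have "\<dots> = (if Z = UNIV then 1 else 0)"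
    unfolding moebius_eq_moebius_rec
    by (subst moebius_rec.simps) (use assms in auto)
  finally show ?thesis .
qed

lemma sum_moebius_containing:
  fixes A :: "('a::{field,finite} ^ 'n::finite) set set"
  assumes "central_arrangement A"
  shows "(\<Sum>X\<in>{X \<in> int_lattice A. S \<subseteq> X}. moebius A X) = (if \<exists>H\<in>A. S \<subseteq> H then 0 else 1)"
proof -
  let ?Z = "\<Inter>{H \<in> A. S \<subseteq> H}"
  have "?Z \<in> int_lattice A"
    by (auto simp: int_lattice_def)
  note sum_moebius_above[OF this]
  moreover have "{X \<in> int_lattice A. S \<subseteq> X} = {X \<in> int_lattice A. ?Z \<subseteq> X}"
    unfolding int_lattice_def by blast
  moreover have "H \<noteq> UNIV" if "H \<in> A" for H
    using assms that hyperplane_neq_UNIV by (auto simp: central_arrangement_def)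
  then have "?Z = UNIV \<longleftrightarrow> \<not> (\<exists>H\<in>A. S \<subseteq> H)"
    by auto
  ultimately show ?thesis
    by simp
qed

lemma card_lists_in_subspace:
  fixes X :: "('a::{field,finite} ^ 'n::finite) set"
  assumes "vec.subspace X"
  shows "card {xs. length xs = s \<and> set xs \<subseteq> X} = (CARD('a) ^ s) ^ vec.dim X"
proof -
  have "card {xs. set xs \<subseteq> X \<and> length xs = s} = card X ^ s"
    by (simp add: card_lists_length_eq)
  then show ?thesis
    by (simp add: conj_commute vec.card_subspace[OF assms] mult.commute flip: power_mult)
qed

theorem poly_char_poly_power:
  fixes A :: "('a::{field,finite} ^ 'n::finite) set set"
  assumes "central_arrangement A"
  shows "poly (char_poly A) (int CARD('a) ^ s)
    = int (card {xs. length xs = s \<and> \<not> (\<exists>H\<in>A. set xs \<subseteq> H)})"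
proof -
  let ?L = "int_lattice A" and ?T = "{xs :: ('a ^ 'n) list. length xs = s}"
  have fin: "finite ?T"
    using finite_lists_length_eq[of "UNIV :: ('a ^ 'n) set" s] by simp
  have card_power: "(int CARD('a) ^ s) ^ vec.dim X = (\<Sum>xs\<in>?T. if set xs \<subseteq> X then 1 else 0)" if "X \<in> ?L" for X
    using card_lists_in_subspace[OF subspace_int_lattice[OF assms that], of s] fin
    by (simp add: sum.If_cases Int_def flip: of_nat_power)
  have "poly (char_poly A) (int CARD('a) ^ s) = (\<Sum>X\<in>?L. moebius A X * (int CARD('a) ^ s) ^ vec.dim X)"
    by (simp add: char_poly_def poly_sum poly_monom)
  also have "\<dots> = (\<Sum>X\<in>?L. \<Sum>xs\<in>?T. if set xs \<subseteq> X then moebius A X else 0)"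
    by (intro sum.cong refl) (simp add: card_power sum_distrib_left if_distrib cong: if_cong)
  also have "\<dots> = (\<Sum>xs\<in>?T. \<Sum>X\<in>{X \<in> ?L. set xs \<subseteq> X}. moebius A X)"
    by (subst sum.swap) (simp add: sum.inter_filter)
  also have "\<dots> = int (card {xs. length xs = s \<and> \<not> (\<exists>H\<in>A. set xs \<subseteq> H)})"
    using fin by (simp add: sum_moebius_containing[OF assms] sum.If_cases Int_def)
  finally show ?thesis .
qed

definition blocking :: "('a::field ^ 'n::finite) set set \<Rightarrow> bool" where
  "blocking A \<longleftrightarrow> (\<forall>X. vec.dim X \<le> CARD('n) - 2 \<longrightarrow> (\<exists>H\<in>A. X \<subseteq> H))"

lemma blocking_mono: "blocking A \<Longrightarrow> A \<subseteq> A' \<Longrightarrow> blocking A'"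
  unfolding blocking_def by (meson subsetD)

lemma blocking_if_char_poly_zero:
  fixes A :: "('a::{field,finite} ^ 'n::finite) set set"
  assumes "central_arrangement A" "poly (char_poly A) (int CARD('a) ^ (CARD('n) - 2)) = 0"
  shows "blocking A"
  unfolding blocking_def
proof (intro allI impI)
  let ?s = "CARD('n) - 2"
  fix X :: "('a ^ 'n) set"
  assume "vec.dim X \<le> ?s"
  obtain B where "X \<subseteq> vec.span B" "card B = vec.dim X"
    using vec.basis_exists[of X] by metis
  obtain xs where "set xs = B" "distinct xs"
    using finite_distinct_list[of B] by auto
  define ys where "ys = xs @ replicate (?s - length xs) 0"
  have "length ys = ?s"
    using \<open>vec.dim X \<le> ?s\<close> \<open>card B = vec.dim X\<close> \<open>set xs = B\<close> \<open>distinct xs\<close>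
    by (simp add: ys_def flip: distinct_card)
  moreover have "finite {xs :: ('a ^ 'n) list. length xs = ?s \<and> \<not> (\<exists>H\<in>A. set xs \<subseteq> H)}"
    using finite_lists_length_eq[of "UNIV :: ('a ^ 'n) set" ?s] by (rule rev_finite_subset) auto
  then have "{xs. length xs = ?s \<and> \<not> (\<exists>H\<in>A. set xs \<subseteq> H)} = {}"
    using assms(2) unfolding poly_char_poly_power[OF assms(1)] by simp
  ultimately obtain H where "H \<in> A" "set ys \<subseteq> H"
    by blast
  then have "vec.span B \<subseteq> H"
    using \<open>set xs = B\<close> central_arrangement_subspace[OF assms(1)]
    by (intro vec.span_minimal) (auto simp: ys_def)
  then show "\<exists>H\<in>A. X \<subseteq> H"
    using \<open>X \<subseteq> vec.span B\<close> \<open>H \<in> A\<close> by blast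
qed

text \<open>In the projective space of linear forms, a blocking arrangement is a set of points meeting the
  line through any two points \<open>a\<close> and \<open>b\<close>.\<close>

lemma blocking_meets_line:
  fixes A :: "('a::field ^ 'n::finite) set set"
  assumes "blocking A" "central_arrangement A" "a \<noteq> 0" "lin_ker a \<notin> A" "b \<notin> vec.span {a}"
  obtains x where "lin_ker (x *s a + b) \<in> A"
proof -
  let ?X = "lin_ker a \<inter> lin_ker b"
  have "vec.subspace ?X"
    by (intro vec.subspace_inter subspace_lin_ker)
  moreover have "?X \<subset> lin_ker a"
    using assms(5) lin_ker_subset_iff[of a b] by blast
  ultimately have "vec.dim ?X < vec.dim (lin_ker a)"
    using vec.span_eq_iff subspace_lin_ker by (metis vec.dim_psubset)
  then have "vec.dim ?X \<le> CARD('n) - 2"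
    by (simp add: dim_lin_ker[OF assms(3)])
  then obtain H where "H \<in> A" "?X \<subseteq> H"
    using assms(1) by (auto simp: blocking_def)
  then obtain c where "c \<noteq> 0" "lin_ker c \<in> A" "?X \<subseteq> lin_ker c"
    using assms(2) by (auto simp: central_arrangement_def is_hyperplane_def)
  then have "c \<in> vec.span {a, b}"
    by (intro in_span_if_Inter_lin_ker_subset) auto
  then obtain x y where c_eq: "c = x *s a + y *s b"
    by (auto simp: vec.span_insert vec.span_singleton algebra_simps)
  have "y \<noteq> 0"
  proof
    assume "y = 0"
    then have "lin_ker c = lin_ker a"
      using \<open>c \<noteq> 0\<close> c_eq by (auto simp: lin_ker_scale)
    then show False
      using assms(4) \<open>lin_ker c \<in> A\<close> by simp
  qed
  then have "lin_ker (inverse y *s c) = lin_ker c"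
    by (simp add: lin_ker_scale)
  moreover have "inverse y *s c = (inverse y * x) *s a + b"
    using \<open>y \<noteq> 0\<close> by (simp add: c_eq vec.scale_right_distrib)
  ultimately show ?thesis
    using \<open>lin_ker c \<in> A\<close> that by metis
qed

section \<open>Substitution homomorphisms\<close>

lemma mconst_0 [simp]: "mconst 0 = 0"
  and mconst_1 [simp]: "mconst 1 = 1"
  by (simp_all add: mconst_def)

lemma mconst_add: "mconst (a + b :: 'a::monoid_add) = mconst a + mconst b"
  by (simp add: mconst_def single_add)

lemma mconst_uminus: "mconst (- a :: 'a::ab_group_add) = - mconst a"
  by (simp add: mconst_def single_uminus)

lemma mconst_mult: "mconst (a * b :: 'a::semiring_0) = mconst a * mconst b"
  by (simp add: mconst_def mult_single)

lemma mconst_power: "mconst (a ^ k :: 'a::semiring_1) = mconst a ^ k"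
  by (induction k) (simp_all add: mconst_mult)

lemma mconst_sum: "mconst (\<Sum>i\<in>I. f i :: 'a::comm_monoid_add) = (\<Sum>i\<in>I. mconst (f i))"
  by (rule sum_comp_morphism[of mconst, unfolded comp_def, symmetric]) (simp_all add: mconst_add)

lemma mconst_inject [simp]: "mconst a = mconst b \<longleftrightarrow> a = b"
  by (metis mconst_def lookup_single_eq)

definition eval_monom :: "('n \<Rightarrow> 'b::comm_monoid_mult) \<Rightarrow> ('n \<Rightarrow>\<^sub>0 nat) \<Rightarrow> 'b" where
  "eval_monom \<rho> m = (\<Prod>i\<in>Poly_Mapping.keys m. \<rho> i ^ Poly_Mapping.lookup m i)"

definition msubst :: "('n \<Rightarrow> ('a::comm_ring_1, 'k) mpoly) \<Rightarrow> ('a, 'n) mpoly \<Rightarrow> ('a, 'k) mpoly" where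
  "msubst \<rho> f = (\<Sum>m\<in>Poly_Mapping.keys f. mconst (Poly_Mapping.lookup f m) * eval_monom \<rho> m)"

lemma eval_monom_superset:
  assumes "finite K" "Poly_Mapping.keys m \<subseteq> K"
  shows "eval_monom \<rho> m = (\<Prod>i\<in>K. \<rho> i ^ Poly_Mapping.lookup m i)"
  unfolding eval_monom_def
  by (rule prod.mono_neutral_left) (use assms in \<open>auto simp: in_keys_iff\<close>)

lemma eval_monom_add: "eval_monom \<rho> (m + m') = eval_monom \<rho> m * eval_monom \<rho> m'"
proof -
  let ?K = "Poly_Mapping.keys m \<union> Poly_Mapping.keys m'"
  have "eval_monom \<rho> k = (\<Prod>i\<in>?K. \<rho> i ^ Poly_Mapping.lookup k i)" if "k \<in> {m, m', m + m'}" for k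
    using that keys_add[of m m'] by (intro eval_monom_superset) auto
  then show ?thesis
    by (simp add: lookup_add power_add prod.distrib)
qed

lemma eval_monom_single [simp]: "eval_monom \<rho> (Poly_Mapping.single i k) = \<rho> i ^ k"
  by (simp add: eval_monom_def)

lemma poly_mapping_eq_sum_single:
  "f = (\<Sum>m\<in>Poly_Mapping.keys f. Poly_Mapping.single m (Poly_Mapping.lookup f m))"
proof (rule poly_mapping_eqI)
  fix k
  have "(\<Sum>m\<in>Poly_Mapping.keys f. Poly_Mapping.lookup (Poly_Mapping.single m (Poly_Mapping.lookup f m)) k)
    = (\<Sum>m\<in>Poly_Mapping.keys f. if m = k then Poly_Mapping.lookup f m else 0)"
    by (intro sum.cong) (auto simp: lookup_single)
  also have "\<dots> = Poly_Mapping.lookup f k"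
    by (simp add: in_keys_iff)
  finally show "Poly_Mapping.lookup f k
    = Poly_Mapping.lookup (\<Sum>m\<in>Poly_Mapping.keys f. Poly_Mapping.single m (Poly_Mapping.lookup f m)) k"
    by (simp add: lookup_sum)
qed

lemma msubst_0 [simp]: "msubst \<rho> 0 = 0"
  by (simp add: msubst_def)

lemma msubst_add: "msubst \<rho> (f + g) = msubst \<rho> f + msubst \<rho> g"
  unfolding msubst_def
  by (rule setsum_keys_plus_distrib) (simp_all add: mconst_add distrib_right)

lemma msubst_single: "msubst \<rho> (Poly_Mapping.single m c) = mconst c * eval_monom \<rho> m"
  by (simp add: msubst_def)

lemma msubst_mconst [simp]: "msubst \<rho> (mconst c) = mconst c"
  using msubst_single[of \<rho> 0 c] by (simp add: eval_monom_def flip: mconst_def)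

lemma msubst_1 [simp]: "msubst \<rho> 1 = 1"
  using msubst_mconst[of \<rho> 1] by simp

lemma msubst_mvar [simp]: "msubst \<rho> (mvar i) = \<rho> i"
  by (simp add: mvar_def msubst_single)

lemma msubst_sum: "msubst \<rho> (\<Sum>i\<in>I. f i) = (\<Sum>i\<in>I. msubst \<rho> (f i))"
  by (rule sum_comp_morphism[of "msubst \<rho>", unfolded comp_def, symmetric]) (simp_all add: msubst_add)

lemma msubst_mult: "msubst \<rho> (f * g) = msubst \<rho> f * msubst \<rho> g"
proof -
  let ?s = "\<lambda>h m. Poly_Mapping.single m (Poly_Mapping.lookup h m)"
  have "f * g = (\<Sum>m\<in>Poly_Mapping.keys f. \<Sum>k\<in>Poly_Mapping.keys g. ?s f m * ?s g k)"
    by (subst poly_mapping_eq_sum_single[of f], subst poly_mapping_eq_sum_single[of g])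
      (simp add: sum_product)
  then have "msubst \<rho> (f * g)
    = (\<Sum>m\<in>Poly_Mapping.keys f. \<Sum>k\<in>Poly_Mapping.keys g. msubst \<rho> (?s f m * ?s g k))"
    by (simp add: msubst_sum)
  also have "\<dots> = (\<Sum>m\<in>Poly_Mapping.keys f. \<Sum>k\<in>Poly_Mapping.keys g.
      (mconst (Poly_Mapping.lookup f m) * eval_monom \<rho> m)
      * (mconst (Poly_Mapping.lookup g k) * eval_monom \<rho> k))"
    by (intro sum.cong refl) (simp add: mult_single msubst_single eval_monom_add mconst_mult mult_ac)
  also have "\<dots> = msubst \<rho> f * msubst \<rho> g"
    by (simp add: msubst_def sum_product)
  finally show ?thesis .
qed

lemma msubst_power: "msubst \<rho> (f ^ k) = msubst \<rho> f ^ k"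
  by (induction k) (simp_all add: msubst_mult)

lemma msubst_diff: "msubst \<rho> (f - g) = msubst \<rho> f - msubst \<rho> g"
  using msubst_add[of \<rho> "f - g" g] by simp

lemma msubst_prod: "msubst \<rho> (\<Prod>i\<in>I. f i) = (\<Prod>i\<in>I. msubst \<rho> (f i))"
  by (induction I rule: infinite_finite_induct) (auto simp: msubst_mult)

lemmas msubst_hom = msubst_add msubst_diff msubst_mult msubst_power msubst_sum msubst_prod

lemma mvar_power: "mvar i ^ k = Poly_Mapping.single (Poly_Mapping.single i k) (1 :: 'a::comm_semiring_1)"
  by (induction k) (simp_all add: mvar_def mult_single flip: single_add)

lemma single_eq_eval_monom:
  "Poly_Mapping.single m c = mconst (c :: 'a::comm_semiring_1) * eval_monom mvar m"
proof -
  have "(\<Prod>i\<in>K. mvar i ^ Poly_Mapping.lookup m i)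
    = Poly_Mapping.single (\<Sum>i\<in>K. Poly_Mapping.single i (Poly_Mapping.lookup m i)) (1::'a)"
    if "finite K" for K using that
    by (induction K) (simp_all add: mvar_power mult_single)
  from this[of "Poly_Mapping.keys m"] have "eval_monom mvar m = Poly_Mapping.single m (1::'a)"
    using poly_mapping_eq_sum_single[of m] by (simp add: eval_monom_def)
  then show ?thesis
    by (simp add: mconst_def mult_single)
qed

lemma mpoly_induct [case_names const var add mult]:
  fixes f :: "('a::comm_semiring_1, 'n) mpoly"
  assumes const: "\<And>c. P (mconst c)" and var: "\<And>i. P (mvar i)"
    and add: "\<And>f g. P f \<Longrightarrow> P g \<Longrightarrow> P (f + g)" and mult: "\<And>f g. P f \<Longrightarrow> P g \<Longrightarrow> P (f * g)"
  shows "P f"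
proof -
  have sum: "P (\<Sum>i\<in>I. h i)" if "\<And>i. P (h i)" for I :: "('n \<Rightarrow>\<^sub>0 nat) set" and h
    by (induction I rule: infinite_finite_induct) (use that const[of 0] in \<open>auto intro: add\<close>)
  have power: "P (mvar i ^ k)" for i k
    by (induction k) (use const[of 1] in \<open>auto intro: mult var\<close>)
  have prod: "P (\<Prod>i\<in>I. h i)" if "\<And>i. P (h i)" for I :: "'n set" and h
    by (induction I rule: infinite_finite_induct) (use that const[of 1] in \<open>auto intro: mult\<close>)
  have "P (Poly_Mapping.single m c)" for m c
    unfolding single_eq_eval_monom eval_monom_def by (intro mult const prod power)
  then show ?thesis
    by (subst poly_mapping_eq_sum_single) (rule sum)
qed

lemma msubst_msubst: "msubst \<sigma> (msubst \<rho> f) = msubst (\<lambda>i. msubst \<sigma> (\<rho> i)) f"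
  by (induction f rule: mpoly_induct) (simp_all add: msubst_add msubst_mult)

lemma msubst_mvar_id [simp]: "msubst mvar f = f"
  by (induction f rule: mpoly_induct) (simp_all add: msubst_add msubst_mult)

lemma dvd_diff_msubst:
  assumes "\<And>i. p dvd mvar i - \<rho> i"
  shows "p dvd f - msubst \<rho> f"
proof (induction f rule: mpoly_induct)
  case (add f g)
  have "f + g - msubst \<rho> (f + g) = (f - msubst \<rho> f) + (g - msubst \<rho> g)"
    by (simp add: msubst_add)
  then show ?case
    using add by (metis dvd_add)
next
  case (mult f g)
  have "f * g - msubst \<rho> (f * g) = (f - msubst \<rho> f) * g + msubst \<rho> f * (g - msubst \<rho> g)"
    by (simp add: msubst_mult algebra_simps)
  then show ?case
    using mult by (metis dvd_add dvd_mult dvd_mult2)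
qed (simp_all add: assms)

section \<open>Polynomials in finitely many variables form a domain\<close>

text \<open>The \<open>idom\<close> instance of \<open>poly_mapping\<close> needs linearly ordered exponents, so the variables
  are numbered.\<close>

definition number_vars :: "('a::comm_ring_1, 'n::finite) mpoly \<Rightarrow> ('a, nat) mpoly" where
  "number_vars = msubst (\<lambda>i. mvar (to_nat_on UNIV i))"

lemma number_vars_inject [simp]:
  fixes f g :: "('a::comm_ring_1, 'n::finite) mpoly"
  shows "number_vars f = number_vars g \<longleftrightarrow> f = g"
proof -
  have "msubst (\<lambda>k. mvar (from_nat_into (UNIV :: 'n set) k)) (number_vars f) = f" for f :: "('a, 'n) mpoly"
    by (simp add: number_vars_def msubst_msubst countable_finite)
  then show ?thesis
    by metis
qed

lemma number_vars_0 [simp]: "number_vars 0 = 0"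
  by (simp add: number_vars_def)

lemma number_vars_eq_0_iff [simp]: "number_vars f = 0 \<longleftrightarrow> f = 0"
  by (metis number_vars_0 number_vars_inject)

lemma mpoly_mult_eq_0_iff:
  fixes f g :: "('a::idom, 'n::finite) mpoly"
  shows "f * g = 0 \<longleftrightarrow> f = 0 \<or> g = 0"
proof -
  have "number_vars (f * g) = number_vars f * number_vars g"
    by (simp add: number_vars_def msubst_mult)
  then show ?thesis
    by (metis mult_eq_0_iff number_vars_eq_0_iff)
qed

lemma mpoly_mult_left_cancel:
  fixes f g h :: "('a::idom, 'n::finite) mpoly"
  assumes "f \<noteq> 0" "f * g = f * h"
  shows "g = h"
proof -
  have "f * (g - h) = 0"
    using assms by (simp add: right_diff_distrib)
  then show ?thesis
    using assms by (simp add: mpoly_mult_eq_0_iff)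
qed

section \<open>Homogeneous components\<close>

definition mhomog :: "nat \<Rightarrow> ('a::zero, 'n) mpoly \<Rightarrow> bool" where
  "mhomog d f \<longleftrightarrow> (\<forall>m\<in>Poly_Mapping.keys f. mon_deg m = d)"

lift_definition hom_component :: "nat \<Rightarrow> ('a::zero, 'n) mpoly \<Rightarrow> ('a, 'n) mpoly"
  is "\<lambda>d f m. if mon_deg m = d then f m else 0"
  by (erule rev_finite_subset) auto

lemma homogeneous_deriv_iff: "homogeneous_deriv \<theta> d \<longleftrightarrow> (\<exists>i. \<theta> i \<noteq> 0) \<and> (\<forall>i. mhomog d (\<theta> i))"
  by (simp add: homogeneous_deriv_def mhomog_def)

lemma mon_deg_add: "mon_deg (m + m') = mon_deg m + mon_deg m'"
  unfolding mon_deg_def by (rule setsum_keys_plus_distrib) simp_all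

lemma mhomog_0 [simp]: "mhomog d 0"
  by (simp add: mhomog_def)

lemma mhomog_mconst [simp]: "mhomog 0 (mconst c)"
  by (simp add: mhomog_def mconst_def mon_deg_def)

lemma mhomog_mult:
  assumes "mhomog d f" "mhomog e g"
  shows "mhomog (d + e) (f * g)"
  using assms keys_mult[of f g] by (auto simp: mhomog_def mon_deg_add)

lemma mhomog_add:
  assumes "mhomog d f" "mhomog d g"
  shows "mhomog d (f + g)"
  using assms keys_add[of f g] by (auto simp: mhomog_def)

lemma mhomog_sum:
  assumes "\<And>i. i \<in> I \<Longrightarrow> mhomog d (f i)"
  shows "mhomog d (\<Sum>i\<in>I. f i)"
  using assms by (induction I rule: infinite_finite_induct) (auto intro: mhomog_add)

lemma mhomog_mvar_power: "mhomog k (mvar i ^ k :: ('a::comm_semiring_1, 'n) mpoly)"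
  by (auto simp: mvar_power mhomog_def mon_deg_def)

lemma mhomog_lin_poly: "mhomog 1 (lin_poly a)"
  unfolding lin_poly_def
  by (intro mhomog_sum) (metis add.left_neutral mhomog_mconst mhomog_mult mhomog_mvar_power power_one_right)

lemma mhomog_hom_component: "mhomog d (hom_component d f)"
  unfolding mhomog_def by transfer auto

lemma hom_component_add: "hom_component d (f + g) = hom_component d f + hom_component d g"
  by transfer auto

lemma hom_component_0 [simp]: "hom_component d 0 = 0"
  by transfer auto

lemma hom_component_sum: "hom_component d (\<Sum>i\<in>I. f i) = (\<Sum>i\<in>I. hom_component d (f i))"
  by (rule sum_comp_morphism[of "hom_component d", unfolded comp_def, symmetric])
    (simp_all add: hom_component_add)

lemma hom_component_mhomog: "mhomog e f \<Longrightarrow> hom_component d f = (if d = e then f else 0)"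
  by (rule poly_mapping_eqI) (auto simp: hom_component.rep_eq mhomog_def in_keys_iff)

lemma eq_sum_hom_components:
  "f = (\<Sum>d\<in>mon_deg ` Poly_Mapping.keys f. hom_component d f)"
  by (rule poly_mapping_eqI) (auto simp: lookup_sum hom_component.rep_eq in_keys_iff sum.delta')

lemma hom_component_mult_mhomog:
  assumes "mhomog e g"
  shows "hom_component d (f * g) = (if e \<le> d then hom_component (d - e) f * g else 0)"
proof -
  let ?D = "mon_deg ` Poly_Mapping.keys f"
  have "hom_component d (hom_component k f * g)
      = (if e \<le> d then hom_component (d - e) (hom_component k f) * g else 0)" for k
    using hom_component_mhomog[OF mhomog_mult[OF mhomog_hom_component[of k f] assms], of d]
      hom_component_mhomog[OF mhomog_hom_component[of k f], of "d - e"] by auto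
  then have "hom_component d ((\<Sum>k\<in>?D. hom_component k f) * g)
      = (if e \<le> d then hom_component (d - e) (\<Sum>k\<in>?D. hom_component k f) * g else 0)"
    by (simp add: sum_distrib_right hom_component_sum)
  then show ?thesis
    by (simp flip: eq_sum_hom_components)
qed

section \<open>Linear polynomials\<close>

lemma lin_poly_eq_apply: "lin_poly a = apply_deriv_lin mvar a"
  by (simp add: lin_poly_def apply_deriv_lin_def)

lemma apply_deriv_lin_add: "apply_deriv_lin \<delta> (a + b) = apply_deriv_lin \<delta> a + apply_deriv_lin \<delta> b"
  by (simp add: apply_deriv_lin_def mconst_add distrib_right sum.distrib)

lemma apply_deriv_lin_scale: "apply_deriv_lin \<delta> (c *s a) = mconst c * apply_deriv_lin \<delta> a"
  by (simp add: apply_deriv_lin_def mconst_mult sum_distrib_left mult.assoc)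

lemma apply_deriv_lin_0 [simp]: "apply_deriv_lin \<delta> 0 = 0"
  by (simp add: apply_deriv_lin_def)

lemma apply_deriv_lin_axis [simp]: "apply_deriv_lin \<delta> (axis i 1) = \<delta> i"
proof -
  have "apply_deriv_lin \<delta> (axis i 1) = (\<Sum>k\<in>UNIV. if k = i then \<delta> k else 0)"
    unfolding apply_deriv_lin_def by (intro sum.cong) (auto simp: axis_def)
  then show ?thesis
    by simp
qed

lemma apply_deriv_lin_fun_diff:
  "apply_deriv_lin (\<lambda>i. \<delta> i - \<epsilon> i) a = apply_deriv_lin \<delta> a - apply_deriv_lin \<epsilon> a"
  by (simp add: apply_deriv_lin_def right_diff_distrib sum_subtractf)

lemma apply_deriv_lin_fun_mult:
  "apply_deriv_lin (\<lambda>i. f * \<delta> i) a = f * apply_deriv_lin \<delta> a"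
  by (simp add: apply_deriv_lin_def sum_distrib_left mult_ac)

lemma msubst_apply_deriv_lin:
  "msubst \<rho> (apply_deriv_lin \<delta> b) = apply_deriv_lin (\<lambda>i. msubst \<rho> (\<delta> i)) b"
  by (simp add: apply_deriv_lin_def msubst_hom)

lemmas lin_poly_add = apply_deriv_lin_add[of mvar, folded lin_poly_eq_apply]
  and lin_poly_scale = apply_deriv_lin_scale[of mvar, folded lin_poly_eq_apply]
  and lin_poly_0 [simp] = apply_deriv_lin_0[of mvar, folded lin_poly_eq_apply]
  and lin_poly_axis [simp] = apply_deriv_lin_axis[of mvar, folded lin_poly_eq_apply]

lemma lin_poly_diff: "lin_poly (a - b) = lin_poly a - lin_poly b"
  using lin_poly_add[of "a - b" b] by simp

lemma lookup_lin_poly: "Poly_Mapping.lookup (lin_poly a) (Poly_Mapping.single i 1) = a $ i"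
proof -
  have "Poly_Mapping.single k (Suc 0) = Poly_Mapping.single i (Suc 0) \<longleftrightarrow> k = i" for k
    by (metis keys_single nat.simps(3) singleton_inject)
  then have "Poly_Mapping.lookup (lin_poly a) (Poly_Mapping.single i 1)
    = (\<Sum>k\<in>UNIV. if k = i then a $ k else 0)"
    unfolding lin_poly_def lookup_sum
    by (intro sum.cong) (auto simp: mconst_def mvar_def mult_single lookup_single)
  then show ?thesis
    by simp
qed

lemma lin_poly_inject [simp]: "lin_poly a = lin_poly b \<longleftrightarrow> a = b"
  by (metis lookup_lin_poly vec_eq_iff)

lemma lin_poly_eq_0_iff [simp]: "lin_poly a = 0 \<longleftrightarrow> a = 0"
  by (metis lin_poly_0 lin_poly_inject)

text \<open>If \<open>scalar_product a v = 1\<close>, this substitution restricts polynomials to the hyperplane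
  \<open>lin_ker a\<close> along the direction \<open>v\<close>: it realises the quotient by \<open>lin_poly a\<close> inside the
  polynomial ring.\<close>

definition ker_proj :: "'a::field ^ 'n::finite \<Rightarrow> 'a ^ 'n \<Rightarrow> 'n \<Rightarrow> ('a, 'n) mpoly" where
  "ker_proj a v i = mvar i - mconst (v $ i) * lin_poly a"

lemma ker_proj_lin_poly:
  "msubst (ker_proj a v) (lin_poly b) = lin_poly (b - scalar_product b v *s a)"
proof -
  have "msubst (ker_proj a v) (lin_poly b) = apply_deriv_lin (ker_proj a v) b"
    by (simp add: lin_poly_eq_apply msubst_apply_deriv_lin)
  also have "\<dots> = lin_poly b - mconst (scalar_product b v) * lin_poly a"
    unfolding ker_proj_def[abs_def] apply_deriv_lin_fun_diff lin_poly_eq_apply[symmetric]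
    by (simp add: apply_deriv_lin_def scalar_product_def mconst_sum mconst_mult sum_distrib_right
        mult.assoc)
  finally show ?thesis
    by (simp add: lin_poly_diff lin_poly_scale)
qed

lemma lin_poly_dvd_diff_ker_proj: "lin_poly a dvd f - msubst (ker_proj a v) f"
  by (rule dvd_diff_msubst) (simp add: ker_proj_def)

lemma lin_poly_dvd_iff_ker_proj:
  assumes "scalar_product a v = 1"
  shows "lin_poly a dvd f \<longleftrightarrow> msubst (ker_proj a v) f = 0"
proof
  have "msubst (ker_proj a v) (lin_poly a) = 0"
    using assms by (simp add: ker_proj_lin_poly)
  then show "msubst (ker_proj a v) f = 0" if "lin_poly a dvd f"
    using that by (auto simp: msubst_mult)
  show "lin_poly a dvd f" if "msubst (ker_proj a v) f = 0"
    using that lin_poly_dvd_diff_ker_proj[of a f v] by simp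
qed

lemma ker_proj_idem:
  assumes "scalar_product a v = 1"
  shows "msubst (ker_proj a v) (msubst (ker_proj a v) f) = msubst (ker_proj a v) f"
  using lin_poly_dvd_diff_ker_proj[of a f v] by (simp add: lin_poly_dvd_iff_ker_proj[OF assms] msubst_diff)

lemma prime_elem_lin_poly:
  assumes "a \<noteq> 0"
  shows "prime_elem (lin_poly a)"
proof -
  obtain v where "scalar_product a v = 1"
    using assms by (rule scalar_product_eq_1_exists)
  then show ?thesis
    unfolding prime_elem_def
    using assms by (simp add: lin_poly_dvd_iff_ker_proj msubst_mult mpoly_mult_eq_0_iff)
qed

lemma lin_poly_dvd_lin_poly_iff:
  fixes a b :: "'a::field ^ 'n::finite"
  shows "lin_poly a dvd lin_poly b \<longleftrightarrow> b \<in> vec.span {a}"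
proof
  assume dvd: "lin_poly a dvd lin_poly b"
  show "b \<in> vec.span {a}"
  proof (cases "a = 0")
    case False
    then obtain v where "scalar_product a v = 1"
      by (rule scalar_product_eq_1_exists)
    then have "b - scalar_product b v *s a = 0"
      using dvd by (simp add: lin_poly_dvd_iff_ker_proj ker_proj_lin_poly)
    then show ?thesis
      by (auto simp: vec.span_singleton)
  qed (use dvd in simp)
qed (auto simp: vec.span_singleton lin_poly_scale)

lemma prime_elem_dvd_prodD:
  assumes "prime_elem p" "p dvd (\<Prod>i\<in>I. f i)"
  shows "\<exists>i\<in>I. p dvd f i"
  using assms(2)
  by (induction I rule: infinite_finite_induct)
    (use assms(1) in \<open>auto dest: prime_elem_dvd_multD prime_elem_not_unit\<close>)

lemma prod_prime_elems_dvd: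
  assumes "finite I" "\<And>i. i \<in> I \<Longrightarrow> prime_elem (p i)" "\<And>i. i \<in> I \<Longrightarrow> p i dvd f"
    and "\<And>i k. i \<in> I \<Longrightarrow> k \<in> I \<Longrightarrow> p i dvd p k \<Longrightarrow> i = k"
  shows "(\<Prod>i\<in>I. p i) dvd f"
  using assms
proof (induction I)
  case (insert i I)
  then obtain g where f_eq: "f = (\<Prod>i\<in>I. p i) * g"
    by (auto elim!: dvdE)
  have prime: "prime_elem (p i)"
    using insert.prems by simp
  have "\<not> p i dvd (\<Prod>k\<in>I. p k)"
    using prime_elem_dvd_prodD[OF prime] insert.prems(3) insert.hyps(2) by (metis insertCI)
  then have "p i dvd g"
    using insert.prems(2)[of i] prime f_eq by (auto dest: prime_elem_dvd_multD)
  then show ?case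
    using f_eq insert.hyps by (auto elim!: dvdE simp: mult_ac)
qed simp

section \<open>Frobenius and \<open>q\<close>-polynomials\<close>

text \<open>The library proves this as \<open>finite_field_power_card_eq_same\<close> for the class \<open>finite_field\<close>, which a
  type of sort \<open>{field,finite}\<close> does not inherit.\<close>

lemma power_CARD_eq_self: "(x :: 'a::{field,finite}) ^ CARD('a) = x"
proof (cases "x = 0")
  case False
  have "(\<Prod>y\<in>UNIV - {0}. y) = (\<Prod>y\<in>UNIV - {0}. x * y)"
    by (rule prod.reindex_bij_witness[of _ "\<lambda>y. x * y" "\<lambda>y. y / x"]) (use False in auto)
  also have "\<dots> = x ^ (CARD('a) - 1) * (\<Prod>y\<in>UNIV - {0}. y)"
    by (simp add: prod.distrib card_Diff_singleton)
  finally have "x ^ (CARD('a) - 1) = 1"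
    by simp
  then have "x ^ Suc (CARD('a) - 1) = x"
    by (simp only: power_Suc mult_1_right)
  moreover have "Suc (CARD('a) - 1) = CARD('a)"
    using CARD_field_gt_1[where 'a = 'a] by simp
  ultimately show ?thesis
    by (simp only:)
qed (use CARD_field_gt_1[where 'a = 'a] in auto)

text \<open>The polynomials \<open>(X + 1)^q\<close> and \<open>X^q + 1\<close> are monic of degree \<open>q\<close> and agree on the field.\<close>

lemma of_nat_CARD_choose_eq_0:
  assumes "0 < i" "i < CARD('a)"
  shows "of_nat (CARD('a) choose i) = (0 :: 'a::{field,finite})"
proof -
  let ?q = "CARD('a)"
  have "[:1, 1 :: 'a:] ^ ?q = monom 1 ?q + 1"
  proof (rule poly_eqI_degree_lead_coeff[where n = ?q and A = UNIV])
    show "coeff ([:1, 1 :: 'a:] ^ ?q) ?q = coeff (monom 1 ?q + 1) ?q"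
      using CARD_field_gt_1[where 'a = 'a] by (simp add: coeff_linear_power)
    show "degree ([:1, 1 :: 'a:] ^ ?q) \<le> ?q"
      by (simp add: degree_linear_power)
    show "degree (monom 1 ?q + 1 :: 'a poly) \<le> ?q"
      by (intro degree_add_le degree_monom_le) simp
  qed (simp_all add: poly_monom power_CARD_eq_self)
  from arg_cong[OF this, of "\<lambda>p. coeff p i"] show ?thesis
    using assms by (simp add: coeff_linear_poly_power coeff_1)
qed

lemma poly_mapping_add_power_CARD:
  fixes f g :: "'m::comm_monoid_add \<Rightarrow>\<^sub>0 'a::{field,finite}"
  shows "(f + g) ^ CARD('a) = f ^ CARD('a) + g ^ CARD('a)"
proof -
  let ?q = "CARD('a)"
  have "(of_nat (?q choose k) :: 'm \<Rightarrow>\<^sub>0 'a) = Poly_Mapping.single 0 (of_nat (?q choose k))" for k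
    by simp
  then have vanish: "(of_nat (?q choose k) :: 'm \<Rightarrow>\<^sub>0 'a) = 0" if "0 < k" "k < ?q" for k
    using that by (simp only: of_nat_CARD_choose_eq_0 single_zero)
  have "(f + g) ^ ?q = (\<Sum>k\<le>?q. of_nat (?q choose k) * f ^ k * g ^ (?q - k))"
    by (rule binomial_ring)
  also have "\<dots> = (\<Sum>k\<in>{0, ?q}. of_nat (?q choose k) * f ^ k * g ^ (?q - k))"
    by (rule sum.mono_neutral_right) (auto simp: vanish)
  also have "\<dots> = f ^ ?q + g ^ ?q"
    using CARD_field_gt_1[where 'a = 'a] by simp
  finally show ?thesis .
qed

lemma frobenius_add:
  fixes f g :: "'m::comm_monoid_add \<Rightarrow>\<^sub>0 'a::{field,finite}"
  shows "(f + g) ^ (CARD('a) ^ k) = f ^ (CARD('a) ^ k) + g ^ (CARD('a) ^ k)"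
proof (induction k)
  case (Suc k)
  have "h ^ (CARD('a) ^ Suc k) = (h ^ (CARD('a) ^ k)) ^ CARD('a)" for h :: "'m \<Rightarrow>\<^sub>0 'a"
    by (simp add: mult.commute flip: power_mult)
  then show ?case
    by (simp add: Suc poly_mapping_add_power_CARD)
qed simp

lemma frobenius_sum:
  fixes f :: "'i \<Rightarrow> 'm::comm_monoid_add \<Rightarrow>\<^sub>0 'a::{field,finite}"
  shows "(\<Sum>i\<in>I. f i) ^ (CARD('a) ^ k) = (\<Sum>i\<in>I. f i ^ (CARD('a) ^ k))"
  by (rule sum_comp_morphism[of "\<lambda>h. h ^ (CARD('a) ^ k)", unfolded comp_def, symmetric])
    (use CARD_field_gt_1[where 'a = 'a] in \<open>auto simp: frobenius_add zero_power\<close>)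

lemma frobenius_scale:
  fixes f :: "('a::{field,finite}, 'n) mpoly"
  shows "(mconst c * f) ^ (CARD('a) ^ k) = mconst c * f ^ (CARD('a) ^ k)"
proof -
  have "c ^ (CARD('a) ^ k) = c"
    by (induction k) (simp_all add: power_CARD_eq_self power_mult)
  then show ?thesis
    by (simp add: power_mult_distrib flip: mconst_power)
qed

definition qpoly :: "nat \<Rightarrow> (nat \<Rightarrow> ('a::{field,finite}, 'n) mpoly) \<Rightarrow> ('a, 'n) mpoly \<Rightarrow> ('a, 'n) mpoly" where
  "qpoly m c t = (\<Sum>k<m. c k * t ^ (CARD('a) ^ k))"

lemma qpoly_Suc: "qpoly (Suc m) c t = qpoly m c t + c m * t ^ (CARD('a) ^ m)"
  for t :: "('a::{field,finite}, 'n) mpoly"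
  by (simp add: qpoly_def)

lemma qpoly_cong: "(\<And>k. k < m \<Longrightarrow> c k = d k) \<Longrightarrow> qpoly m c t = qpoly m d t"
  by (simp add: qpoly_def)

lemma qpoly_add_right: "qpoly m c (s + t) = qpoly m c s + qpoly m c t"
  by (simp add: qpoly_def frobenius_add distrib_left sum.distrib)

lemma qpoly_scale_right: "qpoly m c (mconst x * t) = mconst x * qpoly m c t"
  by (simp add: qpoly_def frobenius_scale sum_distrib_left mult.left_commute)

lemma qpoly_0_right [simp]: "qpoly m c 0 = 0"
  using qpoly_scale_right[of m c 0] by simp

lemma qpoly_sum_right: "qpoly m c (\<Sum>i\<in>I. f i) = (\<Sum>i\<in>I. qpoly m c (f i))"
  by (rule sum_comp_morphism[of "qpoly m c", unfolded comp_def, symmetric]) (simp_all add: qpoly_add_right)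

lemma qpoly_add_left: "qpoly m (\<lambda>k. c k + d k) t = qpoly m c t + qpoly m d t"
  by (simp add: qpoly_def distrib_right sum.distrib)

lemma qpoly_diff_left: "qpoly m (\<lambda>k. c k - d k) t = qpoly m c t - qpoly m d t"
  by (simp add: qpoly_def left_diff_distrib sum_subtractf)

lemma qpoly_uminus_left: "qpoly m (\<lambda>k. - c k) t = - qpoly m c t"
  by (simp add: qpoly_def sum_negf)

lemma qpoly_mult_left: "qpoly m (\<lambda>k. f * c k) t = f * qpoly m c t"
  by (simp add: qpoly_def sum_distrib_left mult.assoc)

lemma qpoly_Suc_fun_upd: "qpoly (Suc m) (c(m := e)) t = qpoly m c t + e * t ^ (CARD('a) ^ m)"
  for t :: "('a::{field,finite}, 'n) mpoly"
  by (simp add: qpoly_Suc cong: qpoly_cong)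

lemma qpoly_extend: "qpoly (Suc m) (c(m := 0)) t = qpoly m c t"
  by (simp add: qpoly_Suc_fun_upd)

lemma qpoly_power_CARD:
  fixes t :: "('a::{field,finite}, 'n) mpoly"
  shows "qpoly m c t ^ CARD('a) = qpoly (Suc m) (case_nat 0 (\<lambda>k. c k ^ CARD('a))) t"
  using frobenius_sum[of "\<lambda>k. c k * t ^ (CARD('a) ^ k)" "{..<m}" 1]
  by (simp add: qpoly_def sum.lessThan_Suc_shift power_mult_distrib mult.commute flip: power_mult
      del: sum.lessThan_Suc)

lemma dvd_qpoly: "p dvd t \<Longrightarrow> p dvd qpoly m c t"
  for t :: "('a::{field,finite}, 'n) mpoly"
  unfolding qpoly_def by (intro dvd_sum dvd_mult dvd_trans[OF _ dvd_power]) simp_all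

lemma msubst_qpoly: "msubst \<rho> (qpoly m c t) = qpoly m (\<lambda>k. msubst \<rho> (c k)) (msubst \<rho> t)"
  by (simp add: qpoly_def msubst_hom)

lemma apply_deriv_lin_qpoly:
  "apply_deriv_lin (\<lambda>i. qpoly m c (mvar i)) a = qpoly m c (lin_poly a)"
  by (simp add: apply_deriv_lin_def lin_poly_def qpoly_sum_right qpoly_scale_right)

lemma poly_eq_prod_diff_roots:
  fixes p :: "'a::idom poly"
  assumes "lead_coeff p = 1" "card R = degree p" "\<And>r. r \<in> R \<Longrightarrow> poly p r = 0"
  shows "poly p x = (\<Prod>r\<in>R. x - r)"
proof (cases "finite R")
  case True
  let ?P = "\<Prod>r\<in>R. [:- r, 1:]"
  have "degree ?P = card R"
    by (subst degree_prod_eq_sum_degree) auto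
  moreover have "lead_coeff ?P = 1"
    by (simp add: lead_coeff_prod)
  moreover have "poly ?P r = 0" if "r \<in> R" for r
    using that True by (auto simp: poly_prod prod_zero_iff)
  ultimately have "p = ?P"
    using assms by (intro poly_eqI_degree_lead_coeff[where n = "degree p" and A = R]) simp_all
  then have "poly p x = poly ?P x"
    by (rule arg_cong)
  then show ?thesis
    by (simp add: poly_prod)
next
  case False
  then show ?thesis
    using assms(1,2) by (auto elim!: degree_eq_zeroE)
qed

lemma prod_add_scalar_multiples_linorder:
  fixes t s :: "('a::{field,finite}, 'n::linorder) mpoly"
  assumes "s \<noteq> 0"
  shows "(\<Prod>c\<in>UNIV. t + mconst c * s) = t ^ CARD('a) - s ^ (CARD('a) - 1) * t"
proof -
  let ?q = "CARD('a)" and ?root = "\<lambda>c. - (mconst c * s)"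
  let ?p = "monom 1 ?q + monom (- (s ^ (?q - 1))) 1"
  have CARD_gt_1: "1 < ?q"
    by (rule CARD_field_gt_1)
  have "degree (monom (- (s ^ (?q - 1))) 1) < degree (monom 1 ?q :: ('a, 'n) mpoly poly)"
    using CARD_gt_1 by (simp add: degree_monom_eq order.strict_trans1[OF degree_monom_le])
  then have "degree ?p = ?q"
    by (subst degree_add_eq_left) (simp_all add: degree_monom_eq)
  moreover have inj: "inj ?root"
    using assms by (auto intro!: injI)
  moreover have "poly ?p (?root c) = 0" for c
  proof -
    have "?root c ^ ?q = (mconst (- c) * s) ^ ?q"
      by (simp add: mconst_uminus)
    also have "\<dots> = mconst (- c) * s ^ ?q"
      using frobenius_scale[of "- c" s 1] by simp
    also have "s ^ ?q = s ^ (?q - 1) * s"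
      using CARD_gt_1 by (simp flip: power_Suc2)
    finally show ?thesis
      by (simp add: poly_monom mconst_uminus mult_ac)
  qed
  ultimately have "poly ?p t = (\<Prod>r\<in>range ?root. t - r)"
    using CARD_gt_1 by (intro poly_eq_prod_diff_roots) (auto simp: card_image)
  then show ?thesis
    by (simp add: poly_monom prod.reindex[OF inj])
qed

lemma prod_add_scalar_multiples:
  fixes t s :: "('a::{field,finite}, 'n::finite) mpoly"
  shows "(\<Prod>c\<in>UNIV. t + mconst c * s) = t ^ CARD('a) - s ^ (CARD('a) - 1) * t"
proof (cases "s = 0")
  case True
  then show ?thesis
    using CARD_field_gt_1[where 'a = 'a] by (simp add: zero_power)
next
  case False
  then have "number_vars (\<Prod>c\<in>UNIV. t + mconst c * s) = number_vars (t ^ CARD('a) - s ^ (CARD('a) - 1) * t)"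
    using prod_add_scalar_multiples_linorder[of "number_vars s" "number_vars t"]
    by (simp add: number_vars_def msubst_hom flip: number_vars_eq_0_iff)
  then show ?thesis
    by simp
qed

lemma qpoly_coeff_eq_0:
  fixes W :: "('a::{field,finite} ^ 'n::finite) set"
  assumes "vec.subspace W" "\<And>w. w \<in> W \<Longrightarrow> qpoly (vec.dim W) c (lin_poly w) = 0" "k < vec.dim W"
  shows "c k = 0"
proof -
  let ?q = "CARD('a)" and ?m = "vec.dim W"
  have CARD_gt_1: "1 < ?q"
    by (rule CARD_field_gt_1)
  let ?p = "\<Sum>i<?m. monom (number_vars (c i)) (?q ^ i)" and ?R = "(\<lambda>w. number_vars (lin_poly w)) ` W"
  have card_R: "card ?R = ?q ^ ?m"
    by (subst card_image) (auto simp: vec.card_subspace[OF assms(1)] intro!: inj_onI)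
  have "?p = 0"
  proof (rule poly_eqI_degree)
    have "degree (monom (number_vars (c i)) (?q ^ i)) \<le> ?q ^ ?m - 1" if "i < ?m" for i
    proof -
      have "?q ^ i < ?q ^ ?m"
        using CARD_gt_1 that by (simp add: power_strict_increasing)
      then show ?thesis
        by (intro order.trans[OF degree_monom_le]) simp
    qed
    then have "degree ?p \<le> ?q ^ ?m - 1"
      by (intro degree_sum_le) auto
    then show "degree ?p < card ?R" "degree 0 < card ?R"
      using CARD_gt_1 card_R by (simp_all add: order.strict_trans1)
    fix z
    assume "z \<in> ?R"
    then obtain w where "w \<in> W" and z_eq: "z = number_vars (lin_poly w)"
      by auto
    have "poly ?p z = number_vars (qpoly ?m c (lin_poly w))"
      by (simp add: z_eq qpoly_def poly_sum poly_monom number_vars_def msubst_hom)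
    then show "poly ?p z = poly 0 z"
      using assms(2)[OF \<open>w \<in> W\<close>] by simp
  qed
  moreover have "coeff ?p (?q ^ k) = (\<Sum>i<?m. if i = k then number_vars (c i) else 0)"
    unfolding coeff_sum coeff_monom using CARD_gt_1 by (intro sum.cong) auto
  ultimately show ?thesis
    using assms(3) by simp
qed

definition subspace_poly :: "('a::{field,finite} ^ 'n::finite) set \<Rightarrow> ('a, 'n) mpoly \<Rightarrow> ('a, 'n) mpoly" where
  "subspace_poly W t = (\<Prod>w\<in>W. t + lin_poly w)"

lemma subspace_poly_lin_poly_eq_0:
  assumes "vec.subspace W" "w \<in> W"
  shows "subspace_poly W (lin_poly w) = 0"
proof -
  have "- w \<in> W" "lin_poly w + lin_poly (- w) = 0"
    using assms by (simp_all add: vec.subspace_neg flip: lin_poly_add)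
  then show ?thesis
    unfolding subspace_poly_def by (intro prod_zero) auto
qed

lemma subspace_poly_span_insert:
  assumes "vec.subspace W" "b \<notin> W"
  shows "subspace_poly (vec.span (insert b W)) t = (\<Prod>c\<in>UNIV. subspace_poly W (t + mconst c * lin_poly b))"
proof -
  have "subspace_poly (vec.span (insert b W)) t = (\<Prod>(c, w)\<in>UNIV \<times> W. t + lin_poly (c *s b + w))"
    using prod.reindex_bij_betw[OF vec.bij_betw_span_insert[OF assms], of "\<lambda>w. t + lin_poly w"]
    by (simp add: subspace_poly_def case_prod_unfold)
  then show ?thesis
    by (simp add: subspace_poly_def prod.cartesian_product lin_poly_add lin_poly_scale add_ac)
qed

lemma subspace_poly_eq_qpoly:
  assumes "vec.subspace W"
  shows "\<exists>c. \<forall>t. subspace_poly W t = qpoly (Suc (vec.dim W)) c t"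
  using assms
proof (induction W rule: vec.subspace_induct)
  case zero
  show ?case
    by (intro exI[of _ "\<lambda>_. 1"]) (simp add: subspace_poly_def qpoly_def)
next
  case (insert b W)
  let ?m = "Suc (vec.dim W)" and ?q = "CARD('a)"
  obtain c where W_qpoly: "\<And>t. subspace_poly W t = qpoly ?m c t"
    using insert.IH by blast
  define f where "f = qpoly ?m c (lin_poly b) ^ (?q - 1)"
  have "subspace_poly (vec.span (insert b W)) t
      = qpoly (Suc ?m) (\<lambda>k. case_nat 0 (\<lambda>k. c k ^ ?q) k - f * (c(?m := 0)) k) t" for t
  proof -
    have "subspace_poly (vec.span (insert b W)) t
        = (\<Prod>x\<in>UNIV. qpoly ?m c t + mconst x * qpoly ?m c (lin_poly b))"
      by (simp add: subspace_poly_span_insert[OF insert.hyps] W_qpoly qpoly_add_right qpoly_scale_right)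
    also have "\<dots> = qpoly ?m c t ^ ?q - f * qpoly ?m c t"
      by (simp add: prod_add_scalar_multiples f_def)
    finally show ?thesis
      by (simp only: qpoly_diff_left qpoly_mult_left qpoly_extend qpoly_power_CARD)
  qed
  then show ?case
    using vec.dim_span_insert[OF insert.hyps] by auto
qed

section \<open>Derivations tangent to hyperplanes\<close>

definition tangent :: "('a::field, 'n::finite) deriv \<Rightarrow> 'a ^ 'n \<Rightarrow> bool" where
  "tangent \<delta> a \<longleftrightarrow> lin_poly a dvd apply_deriv_lin \<delta> a"

lemma tangent_scale: "tangent \<delta> a \<Longrightarrow> tangent \<delta> (c *s a)"
  unfolding tangent_def lin_poly_scale apply_deriv_lin_scale by (rule mult_dvd_mono[OF dvd_refl])

lemma tangent_diff: "tangent \<delta> a \<Longrightarrow> tangent \<epsilon> a \<Longrightarrow> tangent (\<lambda>i. \<delta> i - \<epsilon> i) a"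
  by (simp add: tangent_def apply_deriv_lin_fun_diff)

lemma tangent_qpoly: "tangent (\<lambda>i. qpoly m c (mvar i)) a"
  by (simp add: tangent_def apply_deriv_lin_qpoly dvd_qpoly)

lemma subspace_poly_dvd:
  fixes W :: "('a::{field,finite} ^ 'n::finite) set"
  assumes outside: "vec.subspace W" "b \<notin> W" and dvd: "\<And>w. w \<in> W \<Longrightarrow> lin_poly (b + w) dvd f"
  shows "subspace_poly W (lin_poly b) dvd f"
  unfolding subspace_poly_def
proof (rule prod_prime_elems_dvd)
  fix w
  assume "w \<in> W"
  have "b + w \<noteq> 0"
    using outside \<open>w \<in> W\<close> by (metis add_eq_0_iff2 vec.subspace_neg)
  then show "prime_elem (lin_poly b + lin_poly w)"
    using prime_elem_lin_poly by (simp flip: lin_poly_add)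
  show "lin_poly b + lin_poly w dvd f"
    using dvd[OF \<open>w \<in> W\<close>] by (simp add: lin_poly_add)
  fix v
  assume "v \<in> W" "lin_poly b + lin_poly w dvd lin_poly b + lin_poly v"
  then obtain c where "b + v = c *s (b + w)"
    by (auto simp: lin_poly_dvd_lin_poly_iff vec.span_singleton simp flip: lin_poly_add)
  then have "1 *s b + v = c *s b + c *s w"
    by (simp add: vec.scale_right_distrib)
  then have "1 = c \<and> v = c *s w"
    using \<open>v \<in> W\<close> \<open>w \<in> W\<close> vec.subspace_scale[OF outside(1)] by (intro vec.line_plus_subspace_unique[OF outside])
  then show "w = v"
    by auto
qed simp

text \<open>As \<open>\<delta>\<close> vanishes on \<open>W\<close>, all \<open>lin_poly (b + w)\<close> with \<open>w \<in> W\<close> divide \<open>\<delta> b\<close>.\<close>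

lemma tangent_eq_mult_subspace_poly:
  fixes W :: "('a::{field,finite} ^ 'n::finite) set"
  assumes outside: "vec.subspace W" "b \<notin> W" and vanish: "\<And>w. w \<in> W \<Longrightarrow> apply_deriv_lin \<delta> w = 0"
    and tangent: "\<And>x. x \<in> vec.span (insert b W) \<Longrightarrow> tangent \<delta> x"
  obtains g where "\<And>x. x \<in> vec.span (insert b W) \<Longrightarrow> apply_deriv_lin \<delta> x = g * subspace_poly W (lin_poly x)"
proof -
  obtain c where W_qpoly: "\<And>t. subspace_poly W t = qpoly (Suc (vec.dim W)) c t"
    using subspace_poly_eq_qpoly[OF outside(1)] by blast
  have "lin_poly (b + w) dvd apply_deriv_lin \<delta> b" if "w \<in> W" for w
  proof -
    have "tangent \<delta> (b + w)"
      using that by (intro tangent vec.span_add) (auto intro: vec.span_base)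
    then show ?thesis
      by (simp add: tangent_def apply_deriv_lin_add vanish[OF that])
  qed
  then obtain g where \<delta>_b: "apply_deriv_lin \<delta> b = g * subspace_poly W (lin_poly b)"
    using subspace_poly_dvd[OF outside] by (metis dvd_def mult.commute)
  have "apply_deriv_lin \<delta> x = g * subspace_poly W (lin_poly x)" if x_in: "x \<in> vec.span (insert b W)" for x
  proof -
    obtain k w where x_eq: "x = k *s b + w" and "w \<in> W"
      using x_in unfolding bij_betw_imp_surj_on[OF vec.bij_betw_span_insert[OF outside], symmetric] by auto
    have "subspace_poly W (lin_poly x) = mconst k * subspace_poly W (lin_poly b)"
      using subspace_poly_lin_poly_eq_0[OF outside(1) \<open>w \<in> W\<close>]
      by (simp add: x_eq W_qpoly lin_poly_add lin_poly_scale qpoly_add_right qpoly_scale_right)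
    then show ?thesis
      by (simp add: x_eq apply_deriv_lin_add apply_deriv_lin_scale vanish[OF \<open>w \<in> W\<close>] \<delta>_b mult.left_commute)
  qed
  then show ?thesis
    by (rule that)
qed

lemma tangent_on_subspace_imp_qpoly:
  fixes W :: "('a::{field,finite} ^ 'n::finite) set"
  assumes "vec.subspace W" "\<And>w. w \<in> W \<Longrightarrow> tangent \<delta> w"
  shows "\<exists>c. \<forall>w\<in>W. apply_deriv_lin \<delta> w = qpoly (vec.dim W) c (lin_poly w)"
  using assms
proof (induction W rule: vec.subspace_induct)
  case zero
  show ?case
    by simp
next
  case (insert b W)
  let ?m = "vec.dim W" and ?V = "vec.span (insert b W)"
  have "W \<subseteq> ?V"
    using vec.span_superset[of "insert b W"] by auto
  then obtain c where \<delta>_on_W: "\<And>w. w \<in> W \<Longrightarrow> apply_deriv_lin \<delta> w = qpoly ?m c (lin_poly w)"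
    using insert.IH insert.prems by blast
  let ?\<epsilon> = "\<lambda>i. \<delta> i - qpoly ?m c (mvar i)"
  have "apply_deriv_lin ?\<epsilon> w = 0" if "w \<in> W" for w
    using \<delta>_on_W[OF that] by (simp add: apply_deriv_lin_fun_diff apply_deriv_lin_qpoly)
  moreover have "tangent ?\<epsilon> x" if "x \<in> ?V" for x
    using insert.prems[OF that] by (intro tangent_diff tangent_qpoly)
  ultimately obtain g where \<epsilon>_on_V: "\<And>x. x \<in> ?V \<Longrightarrow> apply_deriv_lin ?\<epsilon> x = g * subspace_poly W (lin_poly x)"
    using tangent_eq_mult_subspace_poly[OF insert.hyps] by blast
  obtain e where W_qpoly: "\<And>t. subspace_poly W t = qpoly (Suc ?m) e t"
    using subspace_poly_eq_qpoly[OF insert.hyps(1)] by blast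
  have "apply_deriv_lin \<delta> x = qpoly (Suc ?m) (\<lambda>k. (c(?m := 0)) k + g * e k) (lin_poly x)" if "x \<in> ?V" for x
    using \<epsilon>_on_V[OF that] unfolding qpoly_add_left qpoly_mult_left qpoly_extend W_qpoly
    by (simp add: apply_deriv_lin_fun_diff apply_deriv_lin_qpoly algebra_simps)
  then show ?case
    using vec.dim_span_insert[OF insert.hyps] by auto
qed

section \<open>Logarithmic derivations\<close>

lemma in_logder_iff:
  fixes A :: "('a::field ^ 'n::finite) set set"
  assumes "central_arrangement A"
  shows "\<delta> \<in> logder A \<longleftrightarrow> (\<forall>a. lin_ker a \<in> A \<longrightarrow> tangent \<delta> a)"
proof
  assume "\<delta> \<in> logder A"
  show "\<forall>a. lin_ker a \<in> A \<longrightarrow> tangent \<delta> a"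
  proof (intro allI impI)
    fix a :: "'a ^ 'n"
    assume "lin_ker a \<in> A"
    let ?b = "alpha (lin_ker a)"
    have "lin_ker ?b = lin_ker a"
      using assms \<open>lin_ker a \<in> A\<close> unfolding central_arrangement_def by (intro alpha_hyperplane) blast
    then obtain c where "a = c *s ?b"
      using lin_ker_subset_iff[of ?b a] by (auto simp: vec.span_singleton)
    moreover have "tangent \<delta> ?b"
      using \<open>\<delta> \<in> logder A\<close> \<open>lin_ker a \<in> A\<close> by (simp add: logder_def tangent_def)
    ultimately show "tangent \<delta> a"
      using tangent_scale by metis
  qed
next
  assume "\<forall>a. lin_ker a \<in> A \<longrightarrow> tangent \<delta> a"
  then show "\<delta> \<in> logder A"
    using assms by (simp add: logder_def central_arrangement_def alpha_hyperplane tangent_def)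
qed

lemma qpoly_in_logder: "(\<lambda>i. qpoly m c (mvar i)) \<in> logder A"
  using tangent_qpoly by (auto simp: logder_def tangent_def)

lemma logder_diff: "\<delta> \<in> logder A \<Longrightarrow> \<epsilon> \<in> logder A \<Longrightarrow> (\<lambda>i. \<delta> i - \<epsilon> i) \<in> logder A"
  by (auto simp: logder_def apply_deriv_lin_fun_diff)

lemma central_arrangement_insert_lin_ker:
  "central_arrangement (insert (lin_ker a) A) \<longleftrightarrow> a \<noteq> 0 \<and> central_arrangement A"
  for a :: "'a::field ^ 'n::finite"
  by (auto simp: central_arrangement_def)

lemma lin_poly_mult_in_logder_insert:
  assumes central: "central_arrangement (insert (lin_ker a) A)" and "\<delta> \<in> logder A"
  shows "(\<lambda>i. lin_poly a * \<delta> i) \<in> logder (insert (lin_ker a) A)"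
  unfolding in_logder_iff[OF central] tangent_def apply_deriv_lin_fun_mult
proof (intro allI impI)
  fix b
  assume b_in: "lin_ker b \<in> insert (lin_ker a) A"
  show "lin_poly b dvd lin_poly a * apply_deriv_lin \<delta> b"
  proof (cases "lin_ker b = lin_ker a")
    case True
    then have "lin_poly b dvd lin_poly a"
      using lin_ker_subset_iff[of b a] by (simp add: lin_poly_dvd_lin_poly_iff)
    then show ?thesis
      by (rule dvd_mult2)
  next
    case False
    have "central_arrangement A"
      using central by (simp add: central_arrangement_insert_lin_ker)
    then have "tangent \<delta> b"
      using \<open>\<delta> \<in> logder A\<close> b_in False by (simp add: in_logder_iff)
    then show ?thesis
      unfolding tangent_def by (rule dvd_mult)
  qed
qed

lemma lin_poly_mult_in_logderD:
  assumes central: "central_arrangement A" and "a \<noteq> 0" "lin_ker a \<notin> A"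
    and "(\<lambda>i. lin_poly a * \<delta> i) \<in> logder A"
  shows "\<delta> \<in> logder A"
  unfolding in_logder_iff[OF central]
proof (intro allI impI)
  fix b
  assume "lin_ker b \<in> A"
  then have "b \<noteq> 0"
    using central by (auto simp: central_arrangement_def)
  have "\<not> lin_poly b dvd lin_poly a"
  proof
    assume "lin_poly b dvd lin_poly a"
    then obtain x where "a = x *s b"
      by (auto simp: lin_poly_dvd_lin_poly_iff vec.span_singleton)
    then have "lin_ker a = lin_ker b"
      using \<open>a \<noteq> 0\<close> by (auto simp: lin_ker_scale)
    then show False
      using \<open>lin_ker a \<notin> A\<close> \<open>lin_ker b \<in> A\<close> by simp
  qed
  moreover have "lin_poly b dvd lin_poly a * apply_deriv_lin \<delta> b"
    using assms(4) \<open>lin_ker b \<in> A\<close>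
    by (simp add: in_logder_iff[OF central] tangent_def apply_deriv_lin_fun_mult)
  ultimately show "tangent \<delta> b"
    using prime_elem_lin_poly[OF \<open>b \<noteq> 0\<close>] by (auto simp: tangent_def dest: prime_elem_dvd_multD)
qed

definition restrict_deriv :: "'a::field ^ 'n::finite \<Rightarrow> 'a ^ 'n \<Rightarrow> ('a, 'n) deriv \<Rightarrow> ('a, 'n) deriv" where
  "restrict_deriv a v \<delta> = (\<lambda>i. msubst (ker_proj a v) (\<delta> i))"

lemma apply_restrict_deriv:
  "apply_deriv_lin (restrict_deriv a v \<delta>) b = msubst (ker_proj a v) (apply_deriv_lin \<delta> b)"
  by (simp add: restrict_deriv_def msubst_apply_deriv_lin)

lemma apply_restrict_deriv_eq_0:
  assumes "scalar_product a v = 1" "tangent \<delta> a"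
  shows "apply_deriv_lin (restrict_deriv a v \<delta>) a = 0"
  using assms(2) by (simp add: apply_restrict_deriv tangent_def lin_poly_dvd_iff_ker_proj[OF assms(1)])

text \<open>This is where the hypothesis on lines enters: the forms \<open>w\<close> and \<open>x *s a + w\<close> agree on \<open>lin_ker a\<close>.\<close>

lemma blocking_imp_tangent_restrict_deriv:
  fixes A :: "('a::{field,finite} ^ 'n::finite) set set"
  assumes central: "central_arrangement (insert (lin_ker a) A)" and "blocking A" "lin_ker a \<notin> A"
    and log: "\<delta> \<in> logder (insert (lin_ker a) A)"
    and pairing: "scalar_product a v = 1" and "w \<in> lin_ker v"
  shows "tangent (restrict_deriv a v \<delta>) w"
proof (cases "w = 0")
  case True
  then show ?thesis
    by (simp add: tangent_def)
next
  case False
  let ?\<delta>' = "restrict_deriv a v \<delta>"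
  have tangent: "tangent \<delta> b" if "lin_ker b \<in> insert (lin_ker a) A" for b
    using log that in_logder_iff[OF central] by blast
  have orthogonal: "scalar_product w v = 0"
    using \<open>w \<in> lin_ker v\<close> by (simp add: in_lin_ker_iff scalar_product_commute)
  then have "w \<notin> vec.span {a}"
    using False pairing by (auto simp: vec.span_singleton scalar_product_scale_left)
  then obtain x where "lin_ker (x *s a + w) \<in> A"
    using blocking_meets_line[OF \<open>blocking A\<close>] central \<open>lin_ker a \<notin> A\<close>
    by (metis central_arrangement_insert_lin_ker)
  then have "lin_poly (x *s a + w) dvd apply_deriv_lin \<delta> (x *s a + w)"
    using tangent unfolding tangent_def by blast
  then have "msubst (ker_proj a v) (lin_poly (x *s a + w)) dvd apply_deriv_lin ?\<delta>' (x *s a + w)"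
    by (auto simp: apply_restrict_deriv msubst_mult elim!: dvdE)
  moreover have "apply_deriv_lin ?\<delta>' a = 0"
    using pairing tangent by (simp add: apply_restrict_deriv_eq_0)
  ultimately show ?thesis
    using pairing orthogonal by (simp add: tangent_def lin_poly_add lin_poly_scale ker_proj_lin_poly
        msubst_add msubst_mult apply_deriv_lin_add apply_deriv_lin_scale)
qed

lemma lin_poly_dvd_diff_qpoly:
  fixes a :: "'a::{field,finite} ^ 'n::finite"
  assumes pairing: "scalar_product a v = 1" and "tangent \<delta> a"
    and on_ker: "\<And>w. w \<in> lin_ker v \<Longrightarrow> apply_deriv_lin (restrict_deriv a v \<delta>) w = qpoly m g (lin_poly w)"
  shows "lin_poly a dvd apply_deriv_lin \<delta> b - qpoly m g (lin_poly b)"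
proof -
  let ?\<phi> = "msubst (ker_proj a v)" and ?\<delta>' = "restrict_deriv a v \<delta>"
  let ?w = "b - scalar_product b v *s a"
  have "?w \<in> lin_ker v"
    using pairing by (simp add: in_lin_ker_iff scalar_product_commute[of v] scalar_product_diff_left
        scalar_product_scale_left)
  moreover have "apply_deriv_lin ?\<delta>' b
      = apply_deriv_lin ?\<delta>' ?w + mconst (scalar_product b v) * apply_deriv_lin ?\<delta>' a"
    by (simp flip: apply_deriv_lin_scale apply_deriv_lin_add)
  ultimately have "?\<phi> (apply_deriv_lin \<delta> b) = qpoly m g (lin_poly ?w)"
    using assms(1,2) by (simp add: on_ker apply_restrict_deriv_eq_0 flip: apply_restrict_deriv)
  then have "?\<phi> (?\<phi> (apply_deriv_lin \<delta> b)) = ?\<phi> (qpoly m g (?\<phi> (lin_poly b)))"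
    by (simp add: ker_proj_lin_poly)
  then have "?\<phi> (apply_deriv_lin \<delta> b - qpoly m g (lin_poly b)) = 0"
    by (simp add: msubst_diff msubst_qpoly ker_proj_idem[OF pairing])
  then show ?thesis
    by (simp add: lin_poly_dvd_iff_ker_proj[OF pairing])
qed

lemma blocking_imp_logder_eq_qpoly_mod_lin_poly:
  fixes A :: "('a::{field,finite} ^ 'n::finite) set set"
  assumes central: "central_arrangement (insert (lin_ker a) A)" and "blocking A" "lin_ker a \<notin> A"
    and log: "\<delta> \<in> logder (insert (lin_ker a) A)"
  obtains g where "\<And>b. lin_poly a dvd apply_deriv_lin \<delta> b - qpoly (CARD('n) - 1) g (lin_poly b)"
proof -
  have "a \<noteq> 0"
    using central by (simp add: central_arrangement_insert_lin_ker)
  then obtain v where pairing: "scalar_product a v = 1"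
    by (rule scalar_product_eq_1_exists)
  then have "vec.dim (lin_ker v) = CARD('n) - 1"
    by (intro dim_lin_ker) auto
  moreover have "tangent (restrict_deriv a v \<delta>) w" if "w \<in> lin_ker v" for w
    using assms pairing that by (rule blocking_imp_tangent_restrict_deriv)
  ultimately obtain g where
    "\<And>w. w \<in> lin_ker v \<Longrightarrow> apply_deriv_lin (restrict_deriv a v \<delta>) w = qpoly (CARD('n) - 1) g (lin_poly w)"
    using tangent_on_subspace_imp_qpoly[OF subspace_lin_ker, of v "restrict_deriv a v \<delta>"] by metis
  moreover have "tangent \<delta> a"
    using log in_logder_iff[OF central] by blast
  ultimately show ?thesis
    using lin_poly_dvd_diff_qpoly[OF pairing] that by blast
qed

lemma lin_poly_dvd_qpoly_coeffs:
  fixes a :: "'a::{field,finite} ^ 'n::finite"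
  assumes "a \<noteq> 0" and dvd: "\<And>i. lin_poly a dvd qpoly (CARD('n) - 1) c (mvar i)" and "k < CARD('n) - 1"
  shows "lin_poly a dvd c k"
proof -
  obtain v where pairing: "scalar_product a v = 1"
    using assms(1) by (rule scalar_product_eq_1_exists)
  then have dim: "vec.dim (lin_ker v) = CARD('n) - 1"
    by (intro dim_lin_ker) auto
  let ?\<phi> = "msubst (ker_proj a v)"
  have "qpoly (CARD('n) - 1) (\<lambda>k. ?\<phi> (c k)) (lin_poly w) = 0" if "w \<in> lin_ker v" for w
  proof -
    have "lin_poly a dvd qpoly (CARD('n) - 1) c (lin_poly w)"
      unfolding apply_deriv_lin_qpoly[symmetric] unfolding apply_deriv_lin_def
      by (intro dvd_sum dvd_mult dvd)
    then have "?\<phi> (qpoly (CARD('n) - 1) c (lin_poly w)) = 0"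
      by (simp add: lin_poly_dvd_iff_ker_proj[OF pairing])
    moreover have "?\<phi> (lin_poly w) = lin_poly w"
      using that by (simp add: ker_proj_lin_poly in_lin_ker_iff scalar_product_commute)
    ultimately show ?thesis
      by (simp add: msubst_qpoly)
  qed
  then have "?\<phi> (c k) = 0"
    using assms(3) by (intro qpoly_coeff_eq_0[OF subspace_lin_ker, of v "\<lambda>k. ?\<phi> (c k)"])
      (simp_all add: dim)
  then show ?thesis
    by (simp add: lin_poly_dvd_iff_ker_proj[OF pairing])
qed

section \<open>Deleting hyperplanes from the full arrangement\<close>

definition frob_deriv :: "nat \<Rightarrow> ('a::{field,finite}, 'n::finite) deriv" where
  "frob_deriv k = (\<lambda>i. mvar i ^ (CARD('a) ^ k))"

lemma homogeneous_frob_deriv: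
  "homogeneous_deriv (frob_deriv k :: ('a::{field,finite}, 'n::finite) deriv) (CARD('a) ^ k)"
proof -
  have "frob_deriv k i \<noteq> (0 :: ('a, 'n) mpoly)" for i
    by (metis frob_deriv_def mvar_power lookup_single_eq lookup_zero zero_neq_one)
  then show ?thesis
    by (simp add: homogeneous_deriv_iff frob_deriv_def mhomog_mvar_power)
qed

lemma frob_deriv_in_logder: "frob_deriv k \<in> logder A"
  using qpoly_in_logder[of "Suc k" "(\<lambda>_. 0)(k := 1)" A] by (simp add: qpoly_def frob_deriv_def)

definition frob_span :: "('a::{field,finite}, 'n::finite) deriv \<Rightarrow> ('a, 'n) deriv set" where
  "frob_span \<theta> = {\<eta>. \<exists>c e. \<forall>i. \<eta> i = qpoly (CARD('n) - 1) c (mvar i) + e * \<theta> i}"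

definition frob_independent :: "('a::{field,finite}, 'n::finite) deriv \<Rightarrow> bool" where
  "frob_independent \<theta> \<longleftrightarrow>
    (\<forall>c e. (\<forall>i. qpoly (CARD('n) - 1) c (mvar i) + e * \<theta> i = 0) \<longrightarrow> e = 0 \<and> (\<forall>k<CARD('n) - 1. c k = 0))"

definition completes_basis :: "('a::{field,finite} ^ 'n::finite) set set \<Rightarrow> ('a, 'n) deriv \<Rightarrow> bool" where
  "completes_basis A \<theta> \<longleftrightarrow> \<theta> \<in> logder A \<and> frob_independent \<theta> \<and> logder A \<subseteq> frob_span \<theta>"

lemma deriv_comb_snoc:
  "deriv_comb cs (map f [0..<m] @ [\<theta>]) i = (\<Sum>k<m. cs ! k * f k i) + cs ! m * \<theta> i"
  by (simp add: deriv_comb_def nth_append)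

lemma is_S_basis_if_completes_basis:
  fixes A :: "('a::{field,finite} ^ 'n::finite) set set"
  assumes "completes_basis A \<theta>"
  shows "is_S_basis (logder A) (map frob_deriv [0..<CARD('n) - 1] @ [\<theta>])"
proof -
  let ?m = "CARD('n) - 1"
  let ?ths = "map frob_deriv [0..<?m] @ [\<theta>]"
  have comb: "deriv_comb cs ?ths i = qpoly ?m ((!) cs) (mvar i) + cs ! ?m * \<theta> i" for cs i
    by (simp only: deriv_comb_snoc qpoly_def frob_deriv_def)
  show ?thesis
    unfolding is_S_basis_def
  proof (intro conjI allI impI ballI)
    show "set ?ths \<subseteq> logder A"
      using assms by (auto simp: completes_basis_def frob_deriv_in_logder)
  next
    fix cs :: "('a, 'n) mpoly list" and c
    assume relation: "length cs = length ?ths" "\<forall>i. deriv_comb cs ?ths i = 0" "c \<in> set cs"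
    then have "cs ! ?m = 0 \<and> (\<forall>k<?m. cs ! k = 0)"
      using assms unfolding completes_basis_def frob_independent_def comb by blast
    moreover obtain k where "k < Suc ?m" "c = cs ! k"
      using relation by (auto simp: in_set_conv_nth)
    ultimately show "c = 0"
      using less_antisym[of k ?m] by metis
  next
    fix \<eta>
    assume "\<eta> \<in> logder A"
    then obtain c e where \<eta>_eq: "\<And>i. \<eta> i = qpoly ?m c (mvar i) + e * \<theta> i"
      using assms unfolding completes_basis_def frob_span_def by blast
    let ?cs = "map c [0..<?m] @ [e]"
    have "qpoly ?m ((!) ?cs) t = qpoly ?m c t" for t
      by (rule qpoly_cong) (simp add: nth_append)
    then have "\<eta> = deriv_comb ?cs ?ths"
      unfolding comb fun_eq_iff \<eta>_eq by (simp add: nth_append)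
    then show "\<exists>cs. length cs = length ?ths \<and> \<eta> = deriv_comb cs ?ths"
      by (intro exI[of _ ?cs]) simp
  qed
qed

lemma free_with_exponents_if_completes_basis:
  fixes A :: "('a::{field,finite} ^ 'n::finite) set set"
  assumes "homogeneous_deriv \<theta> d" "completes_basis A \<theta>"
  shows "free_with_exponents A (mset (map (\<lambda>k. int CARD('a) ^ k) [0..<CARD('n) - 1] @ [int d]))"
  unfolding free_with_exponents_def
proof (intro exI conjI allI impI)
  let ?ths = "map frob_deriv [0..<CARD('n) - 1] @ [\<theta>]"
    and ?ds = "map (\<lambda>k. CARD('a) ^ k) [0..<CARD('n) - 1] @ [d]"
  show "is_S_basis (logder A) ?ths"
    using assms(2) by (rule is_S_basis_if_completes_basis)
  show "homogeneous_deriv (?ths ! j) (?ds ! j)" if "j < length ?ths" for j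
    using that assms(1) by (auto simp: nth_append homogeneous_frob_deriv)
qed (simp_all add: comp_def)

lemma frob_independent_frob_deriv:
  "frob_independent (frob_deriv (CARD('n) - 1) :: ('a::{field,finite}, 'n::finite) deriv)"
  unfolding frob_independent_def
proof (intro allI impI)
  let ?m = "CARD('n) - 1"
  fix c and e :: "('a, 'n) mpoly"
  assume vanish: "\<forall>i. qpoly ?m c (mvar i) + e * frob_deriv ?m i = 0"
  have dim: "vec.dim (UNIV :: ('a ^ 'n) set) = Suc ?m"
    using vec_dim_card[where 'a = 'a and 'n = 'n] by simp
  have "apply_deriv_lin (\<lambda>i. qpoly (Suc ?m) (c(?m := e)) (mvar i)) w = 0" for w :: "'a ^ 'n"
    unfolding qpoly_Suc_fun_upd frob_deriv_def[THEN fun_cong, symmetric]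
    using vanish by (simp add: apply_deriv_lin_def)
  then have "(c(?m := e)) k = 0" if "k < Suc ?m" for k
    using that by (intro qpoly_coeff_eq_0[OF vec.subspace_UNIV, of "c(?m := e)"])
      (simp_all only: apply_deriv_lin_qpoly dim)
  then show "e = 0 \<and> (\<forall>k<?m. c k = 0)"
    by (metis fun_upd_apply less_SucI less_irrefl lessI)
qed

lemma logder_hyperplanes_subset_frob_span:
  "logder {H :: ('a::{field,finite} ^ 'n::finite) set. is_hyperplane H}
    \<subseteq> frob_span (frob_deriv (CARD('n) - 1))"
proof
  let ?m = "CARD('n) - 1"
  fix \<eta> :: "('a, 'n) deriv"
  assume "\<eta> \<in> logder {H. is_hyperplane H}"
  then have "tangent \<eta> w" if "w \<noteq> 0" for w
    using that by (simp add: in_logder_iff central_arrangement_def)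
  moreover have "tangent \<eta> 0"
    by (simp add: tangent_def)
  moreover have "vec.dim (UNIV :: ('a ^ 'n) set) = Suc ?m"
    using vec_dim_card[where 'a = 'a and 'n = 'n] by simp
  ultimately obtain c where "\<And>w. apply_deriv_lin \<eta> w = qpoly (Suc ?m) c (lin_poly w)"
    using tangent_on_subspace_imp_qpoly[OF vec.subspace_UNIV, of \<eta>] by (metis UNIV_I)
  from this[of "axis _ 1"] have "\<eta> i = qpoly ?m c (mvar i) + c ?m * frob_deriv ?m i" for i
    unfolding qpoly_Suc by (simp add: frob_deriv_def)
  then show "\<eta> \<in> frob_span (frob_deriv ?m)"
    unfolding frob_span_def by blast
qed

lemma completes_basis_hyperplanes:
  "completes_basis {H :: ('a::{field,finite} ^ 'n::finite) set. is_hyperplane H} (frob_deriv (CARD('n) - 1))"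
  by (simp add: completes_basis_def frob_deriv_in_logder frob_independent_frob_deriv
      logder_hyperplanes_subset_frob_span del: One_nat_def)

lemma frob_independent_neq_qpoly:
  fixes \<theta> :: "('a::{field,finite}, 'n::finite) deriv"
  assumes "frob_independent \<theta>"
  shows "\<exists>i. \<theta> i \<noteq> qpoly (CARD('n) - 1) c (mvar i)"
proof (rule ccontr)
  assume "\<not> ?thesis"
  then have "qpoly (CARD('n) - 1) (\<lambda>k. - c k) (mvar i) + 1 * \<theta> i = 0" for i
    by (simp add: qpoly_uminus_left)
  then have "1 = (0 :: ('a, 'n) mpoly)"
    using assms unfolding frob_independent_def by blast
  then show False
    by simp
qed

lemma frob_independent_quotient:
  fixes \<theta> :: "('a::{field,finite}, 'n::finite) deriv"
  assumes "frob_independent \<theta>" "f \<noteq> 0"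
    and \<theta>_eq: "\<And>i. \<theta> i = qpoly (CARD('n) - 1) c (mvar i) + f * \<theta>' i"
  shows "frob_independent \<theta>'"
  unfolding frob_independent_def
proof (intro allI impI)
  let ?m = "CARD('n) - 1"
  fix x e
  assume vanish: "\<forall>i. qpoly ?m x (mvar i) + e * \<theta>' i = 0"
  have "qpoly ?m (\<lambda>k. f * x k - e * c k) (mvar i) + e * \<theta> i = f * (qpoly ?m x (mvar i) + e * \<theta>' i)" for i
    by (simp add: \<theta>_eq qpoly_diff_left qpoly_mult_left algebra_simps)
  then have "\<forall>i. qpoly ?m (\<lambda>k. f * x k - e * c k) (mvar i) + e * \<theta> i = 0"
    using vanish by simp
  then have "e = 0 \<and> (\<forall>k<?m. f * x k - e * c k = 0)"
    using assms(1) unfolding frob_independent_def by blast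
  then show "e = 0 \<and> (\<forall>k<?m. x k = 0)"
    using \<open>f \<noteq> 0\<close> by (auto simp: mpoly_mult_eq_0_iff)
qed

lemma in_frob_span_quotient:
  fixes \<theta> :: "('a::{field,finite}, 'n::finite) deriv"
  assumes "a \<noteq> 0" and \<theta>_eq: "\<And>i. \<theta> i = qpoly (CARD('n) - 1) c (mvar i) + lin_poly a * \<theta>' i"
    and "(\<lambda>i. lin_poly a * \<eta> i) \<in> frob_span \<theta>"
  shows "\<eta> \<in> frob_span \<theta>'"
proof -
  let ?m = "CARD('n) - 1"
  obtain y e where "\<And>i. lin_poly a * \<eta> i = qpoly ?m y (mvar i) + e * \<theta> i"
    using assms(3) unfolding frob_span_def by blast
  then have \<eta>_eq: "lin_poly a * (\<eta> i - e * \<theta>' i) = qpoly ?m (\<lambda>k. y k + e * c k) (mvar i)" for i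
    by (simp add: \<theta>_eq qpoly_add_left qpoly_mult_left algebra_simps)
  have "lin_poly a dvd qpoly ?m (\<lambda>k. y k + e * c k) (mvar i)" for i
    unfolding \<eta>_eq[symmetric] by (rule dvd_triv_left)
  then have "lin_poly a dvd y k + e * c k" if "k < ?m" for k
    using that by (intro lin_poly_dvd_qpoly_coeffs[OF \<open>a \<noteq> 0\<close>, of "\<lambda>k. y k + e * c k"])
  then obtain x where quotient: "\<And>k. k < ?m \<Longrightarrow> y k + e * c k = lin_poly a * x k"
    unfolding dvd_def by metis
  have "lin_poly a * (\<eta> i - e * \<theta>' i) = lin_poly a * qpoly ?m x (mvar i)" for i
    unfolding \<eta>_eq qpoly_mult_left[symmetric] by (rule qpoly_cong) (rule quotient)
  then have "\<eta> i - e * \<theta>' i = qpoly ?m x (mvar i)" for i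
    using mpoly_mult_left_cancel[of "lin_poly a"] \<open>a \<noteq> 0\<close> by simp
  then have "\<eta> i = qpoly ?m x (mvar i) + e * \<theta>' i" for i
    by (metis diff_add_cancel)
  then show ?thesis
    unfolding frob_span_def by blast
qed

lemma completes_basis_delete:
  fixes A :: "('a::{field,finite} ^ 'n::finite) set set"
  assumes central: "central_arrangement (insert (lin_ker a) A)" and new: "lin_ker a \<notin> A"
    and basis: "completes_basis (insert (lin_ker a) A) \<theta>"
    and \<theta>_eq: "\<And>i. \<theta> i = qpoly (CARD('n) - 1) c (mvar i) + lin_poly a * \<theta>' i"
  shows "completes_basis A \<theta>'"
  unfolding completes_basis_def
proof (intro conjI subsetI)
  have "a \<noteq> 0" "central_arrangement A"
    using central by (simp_all add: central_arrangement_insert_lin_ker)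
  have "\<theta> \<in> logder A"
    using basis by (simp add: completes_basis_def logder_def)
  then have "(\<lambda>i. \<theta> i - qpoly (CARD('n) - 1) c (mvar i)) \<in> logder A"
    by (intro logder_diff qpoly_in_logder)
  then show "\<theta>' \<in> logder A"
    using lin_poly_mult_in_logderD[OF \<open>central_arrangement A\<close> \<open>a \<noteq> 0\<close> new] by (simp add: \<theta>_eq)
  show "frob_independent \<theta>'"
    using basis \<open>a \<noteq> 0\<close> \<theta>_eq frob_independent_quotient[of \<theta> "lin_poly a"] by (simp add: completes_basis_def)
  fix \<eta>
  assume "\<eta> \<in> logder A"
  then have "(\<lambda>i. lin_poly a * \<eta> i) \<in> frob_span \<theta>"
    using lin_poly_mult_in_logder_insert[OF central] basis unfolding completes_basis_def by blast
  then show "\<eta> \<in> frob_span \<theta>'"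
    by (rule in_frob_span_quotient[OF \<open>a \<noteq> 0\<close> \<theta>_eq])
qed

lemma homogeneous_qpoly_remainder:
  fixes \<theta> :: "('a::{field,finite}, 'n::finite) deriv"
  assumes homogeneous: "\<And>i. mhomog d (\<theta> i)" and dvd: "\<And>i. lin_poly a dvd \<theta> i - qpoly m g (mvar i)"
  obtains c \<theta>' where "\<And>i. \<theta> i = qpoly m c (mvar i) + lin_poly a * \<theta>' i"
    and "\<And>i. mhomog (d - 1) (\<theta>' i)" "d = 0 \<Longrightarrow> \<theta>' = (\<lambda>_. 0)"
proof -
  let ?q = "CARD('a)"
  obtain r where quotient: "\<And>i. \<theta> i - qpoly m g (mvar i) = lin_poly a * r i"
    using dvd unfolding dvd_def by metis
  define c where "c k = (if ?q ^ k \<le> d then hom_component (d - ?q ^ k) (g k) else 0)" for k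
  define \<theta>' where "\<theta>' i = (if 1 \<le> d then hom_component (d - 1) (r i) else 0)" for i
  have "\<theta> i = qpoly m c (mvar i) + lin_poly a * \<theta>' i" for i
  proof -
    have "\<theta> i = hom_component d (\<theta> i)"
      using hom_component_mhomog[OF homogeneous, of d i] by simp
    also have "\<dots> = hom_component d ((\<Sum>k<m. g k * mvar i ^ (?q ^ k)) + r i * lin_poly a)"
      using quotient[of i] by (simp add: qpoly_def algebra_simps)
    also have "\<dots> = (\<Sum>k<m. hom_component d (g k * mvar i ^ (?q ^ k))) + hom_component d (r i * lin_poly a)"
      by (simp add: hom_component_add hom_component_sum)
    also have "\<dots> = qpoly m c (mvar i) + lin_poly a * \<theta>' i"
      unfolding hom_component_mult_mhomog[OF mhomog_mvar_power]
        hom_component_mult_mhomog[OF mhomog_lin_poly] qpoly_def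
      by (intro arg_cong2[where f = plus] sum.cong) (auto simp: c_def \<theta>'_def)
    finally show ?thesis .
  qed
  moreover have "mhomog (d - 1) (\<theta>' i)" for i
    by (simp add: \<theta>'_def mhomog_hom_component)
  ultimately show ?thesis
    by (rule that) (auto simp: \<theta>'_def)
qed

lemma homogeneous_completion_delete:
  fixes A :: "('a::{field,finite} ^ 'n::finite) set set"
  assumes central: "central_arrangement (insert (lin_ker a) A)" and "blocking A" and new: "lin_ker a \<notin> A"
    and "homogeneous_deriv \<theta> d" and basis: "completes_basis (insert (lin_ker a) A) \<theta>"
  obtains \<theta>' d' where "d = Suc d'" "homogeneous_deriv \<theta>' d'" "completes_basis A \<theta>'"
proof -
  let ?m = "CARD('n) - 1"
  have "\<theta> \<in> logder (insert (lin_ker a) A)"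
    using basis by (simp add: completes_basis_def)
  then obtain g where "\<And>b. lin_poly a dvd apply_deriv_lin \<theta> b - qpoly ?m g (lin_poly b)"
    using blocking_imp_logder_eq_qpoly_mod_lin_poly[OF central \<open>blocking A\<close> new] by blast
  from this[of "axis _ 1"] have "lin_poly a dvd \<theta> i - qpoly ?m g (mvar i)" for i
    by simp
  moreover have "mhomog d (\<theta> i)" for i
    using \<open>homogeneous_deriv \<theta> d\<close> by (simp add: homogeneous_deriv_iff)
  ultimately obtain c \<theta>' where \<theta>_eq: "\<And>i. \<theta> i = qpoly ?m c (mvar i) + lin_poly a * \<theta>' i"
    and homogeneous: "\<And>i. mhomog (d - 1) (\<theta>' i)" and degenerate: "d = 0 \<Longrightarrow> \<theta>' = (\<lambda>_. 0)"
    using homogeneous_qpoly_remainder by metis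
  obtain i where "\<theta> i \<noteq> qpoly ?m c (mvar i)"
    using frob_independent_neq_qpoly basis unfolding completes_basis_def by blast
  then have "\<theta>' i \<noteq> 0"
    using \<theta>_eq[of i] by auto
  then have "homogeneous_deriv \<theta>' (d - 1)"
    using homogeneous by (auto simp: homogeneous_deriv_iff)
  moreover have "d = Suc (d - 1)"
    using degenerate \<open>\<theta>' i \<noteq> 0\<close> by (cases d) auto
  moreover have "completes_basis A \<theta>'"
    using central new basis \<theta>_eq by (rule completes_basis_delete)
  ultimately show ?thesis
    using that by blast
qed

lemma homogeneous_completion_Diff:
  fixes A :: "('a::{field,finite} ^ 'n::finite) set set"
  assumes "central_arrangement A" "blocking A" "D \<subseteq> {H. is_hyperplane H} - A"
  shows "\<exists>\<theta> d. homogeneous_deriv \<theta> d \<and> completes_basis ({H. is_hyperplane H} - D) \<theta>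
    \<and> d + card D = CARD('a) ^ (CARD('n) - 1)"
  using finite[of D] assms(3)
proof (induction D)
  case empty
  show ?case
    using homogeneous_frob_deriv[of "CARD('n) - 1"] completes_basis_hyperplanes by (intro exI conjI) auto
next
  case (insert H D)
  let ?U = "{H :: ('a ^ 'n) set. is_hyperplane H}"
  obtain \<theta> d where homogeneous: "homogeneous_deriv \<theta> d" and basis: "completes_basis (?U - D) \<theta>"
    and degree: "d + card D = CARD('a) ^ (CARD('n) - 1)"
    using insert by blast
  obtain a where H_eq: "H = lin_ker a"
    using insert.prems by (auto simp: is_hyperplane_def)
  have reinsert: "insert (lin_ker a) (?U - insert H D) = ?U - D"
    using insert H_eq by auto
  have "central_arrangement (insert (lin_ker a) (?U - insert H D))"
    unfolding reinsert by (simp add: central_arrangement_def)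
  moreover have "A \<subseteq> ?U - insert H D"
    using insert.prems assms(1) by (auto simp: central_arrangement_def)
  then have "blocking (?U - insert H D)"
    using assms(2) blocking_mono by blast
  moreover have "lin_ker a \<notin> ?U - insert H D"
    by (simp add: H_eq)
  moreover have "completes_basis (insert (lin_ker a) (?U - insert H D)) \<theta>"
    unfolding reinsert by (rule basis)
  ultimately obtain \<theta>' d' where "d = Suc d'" "homogeneous_deriv \<theta>' d'"
    "completes_basis (?U - insert H D) \<theta>'"
    using homogeneous_completion_delete homogeneous by blast
  then show ?case
    using degree insert.hyps by (intro exI[of _ \<theta>'] exI[of _ d']) auto
qed

lemma homogeneous_completion_blocking:
  fixes A :: "('a::{field,finite} ^ 'n::finite) set set"
  assumes "central_arrangement A" "blocking A"
  obtains \<theta> d where "homogeneous_deriv \<theta> d" "completes_basis A \<theta>"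
    "d + (\<Sum>k<CARD('n) - 1. CARD('a) ^ k) = card A"
proof -
  let ?U = "{H :: ('a ^ 'n) set. is_hyperplane H}" and ?q = "CARD('a)" and ?m = "CARD('n) - 1"
  have "A \<subseteq> ?U"
    using assms(1) by (auto simp: central_arrangement_def)
  then have "?U - (?U - A) = A"
    by blast
  then obtain \<theta> d where "homogeneous_deriv \<theta> d" "completes_basis A \<theta>"
    and degree: "d + card (?U - A) = ?q ^ ?m"
    using homogeneous_completion_Diff[OF assms order_refl] by metis
  have "card (?U - A) + card A = card ?U"
    using card_Diff_subset[OF _ \<open>A \<subseteq> ?U\<close>] card_mono[OF _ \<open>A \<subseteq> ?U\<close>] by simp
  also have "\<dots> = (\<Sum>k<?m. ?q ^ k) + ?q ^ ?m"
    using card_hyperplanes[where 'a = 'a and 'n = 'n] sum.lessThan_Suc[of "\<lambda>k. ?q ^ k" ?m] by simp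
  finally have "d + (\<Sum>k<?m. ?q ^ k) = card A"
    using degree by simp
  with \<open>homogeneous_deriv \<theta> d\<close> \<open>completes_basis A \<theta>\<close> show ?thesis
    by (rule that)
qed

theorem mainTheorem7:
  fixes A :: "('a::{field,finite} ^ 'n::finite) set set"
  assumes "CARD('n) \<ge> 2"
    and "central_arrangement A"
    and "poly (char_poly A) (int CARD('a) ^ (CARD('n) - 2)) = 0"
  shows "free_with_exponents A
           (mset (map (\<lambda>k. int CARD('a) ^ k) [0..<CARD('n) - 1]
              @ [int (card A) - 1 - (\<Sum>k=1..CARD('n) - 2. int CARD('a) ^ k)]))"
proof -
  have "blocking A"
    using assms(2,3) by (rule blocking_if_char_poly_zero)
  with assms(2) obtain \<theta> d where "homogeneous_deriv \<theta> d" "completes_basis A \<theta>"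
    and card_A: "d + (\<Sum>k<CARD('n) - 1. CARD('a) ^ k) = card A"
    by (rule homogeneous_completion_blocking)
  then have "free_with_exponents A (mset (map (\<lambda>k. int CARD('a) ^ k) [0..<CARD('n) - 1] @ [int d]))"
    by (intro free_with_exponents_if_completes_basis)
  moreover have "{..<CARD('n) - 1} = insert 0 {1..CARD('n) - 2}"
    using assms(1) by auto
  then have "int d = int (card A) - 1 - (\<Sum>k=1..CARD('n) - 2. int CARD('a) ^ k)"
    unfolding card_A[symmetric] by simp
  ultimately show ?thesis
    by simp
qed

end
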